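(* Let $Y_m=G(\nu_m)$, $m=1,\dots,M$, be a finite collection of observations of a generalized Gaussian process $G\sim\mathcal N(0,\mathrm A_{\boldsymbol\phi})$ in $\mathcal S'$ that is whitened by a $\boldsymbol p$-admissible operator $\mathrm L$. Then, under the condition that $\mathcal N_{\boldsymbol\phi}\subset\mathrm{span}\{\nu_m\}_{m=1}^M\subset\mathcal H'$, the MMSE interpolator of $G$ given the observed data $\boldsymbol Y=\mathbf y$ is the generalized spline interpolant $$g_0=\arg\min_{g\in\mathcal H}\|\mathrm Lg\|_{L_2}\quad\text{s.t.}\quad\boldsymbol\nu(g)=\mathbf y.$$ It is such that $\mathbb E\{G(\varphi)|\mathbf y\}=g_0(\varphi)$ for any $\varphi\in\mathcal H'\supset\mathcal S$.
   Context: All vector spaces are real. $(\mathcal S,\mathcal S')$ is a dual pair of complete nuclear spaces, which are reflexive ($\mathcal S''=\mathcal S$), with $\mathcal S$ canonically, continuously and densely embedded in $\mathcal S'$. $\langle\cdot,\cdot\rangle$ is the duality product, used with either order of arguments and extended by continuity to dual pairs of Hilbert spaces lying between $\mathcal S$ and $\mathcal S'$. The pivot space $L_2$ is the completion of $\mathcal S$ in the norm $\|\varphi\|_2=\sqrt{\langle\varphi,\varphi\rangle}$, identified with its own dual. A superscript $\ast$ on an operator denotes its adjoint with respect to duality products. $\boldsymbol p=(p_1,\dots,p_{N_0})$ is a linearly independent family in $\mathcal S'$, $\mathcal N_{\boldsymbol p}=\mathrm{span}\{p_n\}$, $\boldsymbol p(f)=(\langle p_n,f\rangle)_{n=1}^{N_0}$,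 $\mathcal S_{\boldsymbol p}=\{\varphi\in\mathcal S:\boldsymbol p(\varphi)=\boldsymbol0\}$. An operator $\mathrm L:\mathcal S\to L_2$ is $\boldsymbol p$-admissible if: (1) there exists an inverse operator $\mathrm L^{-1}$ such that $\mathrm L^{-1}\mathrm L\varphi=\mathrm L\mathrm L^{-1}\varphi=\varphi$ for all $\varphi\in\mathcal S$; (2) its Gram operator $\mathrm A=(\mathrm L^\ast\mathrm L)^{-1}=\mathrm L^{-1}\mathrm L^{-1\ast}:\mathcal S\to\mathcal S'$ is continuous and $\boldsymbol p$-conditionally positive-definite, i.e. $\langle\mathrm A\varphi,\varphi\rangle>0$ for all $\varphi\in\mathcal S_{\boldsymbol p}\setminus\{0\}$; (3) $\mathcal N_{\boldsymbol p}\subseteq\mathcal N_{\mathrm L}\subset\mathcal S'$, where $\mathcal N_{\mathrm L}$ is the null space of $\mathrm L$ extended to the largest possible class of functions/distributions in $\mathcal S'$. A biorthogonal system $(\boldsymbol p,\boldsymbol\phi)$ consists of $\boldsymbol p$ and $\boldsymbol\phi=(\phi_1,\dots,\phi_{N_0})$, with $\phi_n\in\mathcal S$ or more generally $\phi_n\in\mathcal H'$ (below), such that $\langle p_n,\phi_m\rangle=\delta_{m-n}$ (Kronecker delta). $\mathcal N_{\boldsymbol\phi}=\mathrm{span}\{\phi_n\}$; $\mathrm R_{\boldsymbol p}f=\sum_np_n\langle p_n,f\rangle$; $\mathrm R_{\boldsymbol\phi}f=\sum_n\phi_n\langle\phi_n,f\rangle$; and $$\mathrm A_{\boldsymbol\phi}=(\mathrm{Id}-\mathrm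 R_{\boldsymbol p}\mathrm R_{\boldsymbol\phi})\,\mathrm A\,(\mathrm{Id}-\mathrm R_{\boldsymbol\phi}\mathrm R_{\boldsymbol p}),\qquad\mathrm A=(\mathrm L^\ast\mathrm L)^{-1}.$$ The Hilbert space $\mathcal H'$ is the completion of $\mathcal S$ in the inner product $\langle f,g\rangle_{\mathcal H'}=\langle(\mathrm A_{\boldsymbol\phi}+\mathrm R_{\boldsymbol p})f,g\rangle$; it decomposes as $\mathcal H'=\mathcal H_{\mathrm A}\oplus\mathcal N_{\boldsymbol\phi}$ with $\mathcal H_{\mathrm A}=\{f\in\mathcal H':\boldsymbol p(f)=\boldsymbol0\}$. Its predual is the native space $\mathcal H=\mathcal H_{\mathrm L}=\mathcal H_{\mathrm A}'\oplus\mathcal N_{\boldsymbol p}$ with norm $\|f\|_{\mathcal H}^2=\|\mathrm Lf\|_{L_2}^2+\sum_{n=1}^{N_0}|\langle\phi_n,f\rangle|^2$, on which $\mathrm L$ extends to a continuous operator $\mathrm L:\mathcal H\to L_2$ that is an isometric bijection from $\mathcal H_{\mathrm A}'$ onto $L_2$ and vanishes on $\mathcal N_{\boldsymbol p}$. A generalized Gaussian process $G\sim\mathcal N(0,\mathrm A_{\boldsymbol\phi})$ in $\mathcal S'$ is a random continuous linear functional on $\mathcal S$ (realizations in $\mathcal S'$) for which every vector $(G(\varphi_1),\dots,G(\varphi_N))$ is Gaussian (possibly degenerate) with zero mean and covariance matrix $[\langle\mathrm A_{\boldsymbol\phi}\varphi_m,\varphi_n\rangle]_{m,n}$; its characteristic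 functional is $\exp(-\tfrac12\langle\mathrm A_{\boldsymbol\phi}\varphi,\varphi\rangle)$. Its action is extended from $\mathcal S$ to $\mathcal H'$ by continuity/density, with the same formulas; in particular $G(\phi)=0$ for all $\phi\in\mathcal N_{\boldsymbol\phi}$ (boundary conditions). That $G$ is whitened by $\mathrm L$ means that $\mathrm L\{G\}:\varphi\mapsto G(\mathrm L^\ast\varphi)$ is the white Gaussian noise $W\sim\mathcal N(0,\mathrm{Id})$. The $\nu_m$ are linearly independent. For $f\in\mathcal H$, $\boldsymbol\nu(f)=(\langle\nu_1,f\rangle,\dots,\langle\nu_M,f\rangle)$ and, for $\varphi\in\mathcal H'$, $f(\varphi)=\langle f,\varphi\rangle$. $\boldsymbol Y=(Y_1,\dots,Y_M)$, $\mathbf y\in\mathbb R^M$ is an observed value (realization) of $\boldsymbol Y$, and $\mathbb E\{\cdot|\mathbf y\}$ means $\mathbb E\{\cdot|\boldsymbol Y=\mathbf y\}$. The MMSE interpolator is the estimator of $G(\varphi)$ from the noise-free data $\boldsymbol Y$ that minimizes the mean-square error, i.e. the conditional mean. *)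

theory Defs
  imports "HOL-Probability.Probability"
begin

section \<open>Complete nuclear spaces and strong duality\<close>

class locally_convex_space = real_vector + topological_ab_group_add + t2_space +
  assumes tendsto_scaleR_Pair:
    "LIM x (nhds (c::real) \<times>\<^sub>F nhds a). fst x *\<^sub>R snd x :> nhds (c *\<^sub>R a)"
  and locally_convex:
    "open U \<Longrightarrow> 0 \<in> U \<Longrightarrow> \<exists>V. open V \<and> 0 \<in> V \<and> V \<subseteq> U \<and>
      (\<forall>x\<in>V. \<forall>y\<in>V. \<forall>u\<ge>0. \<forall>v\<ge>0. u + v = (1::real) \<longrightarrow> u *\<^sub>R x + v *\<^sub>R y \<in> V)"

definition cauchy_tvs :: "'a::locally_convex_space filter \<Rightarrow> bool" where
  "cauchy_tvs F \<longleftrightarrow> (\<forall>U. open U \<and> 0 \<in> U \<longrightarrow>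
     (\<exists>A. eventually (\<lambda>x. x \<in> A) F \<and> (\<forall>x\<in>A. \<forall>y\<in>A. x - y \<in> U)))"

definition continuous_seminorm :: "('a::locally_convex_space \<Rightarrow> real) \<Rightarrow> bool" where
  "continuous_seminorm q \<longleftrightarrow> (\<forall>x y. q (x + y) \<le> q x + q y) \<and>
     (\<forall>c x. q (c *\<^sub>R x) = \<bar>c\<bar> * q x) \<and> continuous_on UNIV q"

text \<open>The canonical map from the space seminormed by \<open>q\<close> to the space seminormed by \<open>r\<close> is
  nuclear: \<open>x = \<Sum>i. f i x *\<^sub>R y i\<close> with respect to \<open>r\<close>, where the sum over \<open>i\<close> of the dual
  \<open>q\<close>-norm of \<open>f i\<close> (at most \<open>c i\<close>) times \<open>r (y i)\<close> is finite.\<close>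

definition nuclear_canonical_map ::
    "('a::locally_convex_space \<Rightarrow> real) \<Rightarrow> ('a \<Rightarrow> real) \<Rightarrow> bool" where
  "nuclear_canonical_map q r \<longleftrightarrow>
     (\<exists>(f :: nat \<Rightarrow> 'a \<Rightarrow> real) (y :: nat \<Rightarrow> 'a) (c :: nat \<Rightarrow> real).
        (\<forall>i. linear (f i) \<and> 0 \<le> c i \<and> (\<forall>x. \<bar>f i x\<bar> \<le> c i * q x)) \<and>
        summable (\<lambda>i. c i * r (y i)) \<and>
        (\<forall>x. (\<lambda>n. r (x - (\<Sum>i<n. f i x *\<^sub>R y i))) \<longlonglongrightarrow> 0))"

definition complete_nuclear :: "'a::locally_convex_space itself \<Rightarrow> bool" where
  "complete_nuclear _ \<longleftrightarrow>
     (\<forall>F :: 'a filter. F \<noteq> bot \<and> cauchy_tvs F \<longrightarrow> (\<exists>x. F \<le> nhds x)) \<and>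
     (\<forall>r :: 'a \<Rightarrow> real. continuous_seminorm r \<longrightarrow>
        (\<exists>q. continuous_seminorm q \<and> (\<forall>x. r x \<le> q x) \<and> nuclear_canonical_map q r))"

definition bounded_tvs :: "'a::locally_convex_space set \<Rightarrow> bool" where
  "bounded_tvs B \<longleftrightarrow> (\<forall>U. open U \<and> 0 \<in> U \<longrightarrow>
     (\<exists>r>0. \<forall>t\<ge>r. B \<subseteq> (\<lambda>x. t *\<^sub>R x) ` U))"

text \<open>\<open>'d\<close> is, via the duality product \<open>pair\<close>, the topological dual of \<open>'s\<close>, with the strong
  topology (uniform convergence on bounded sets). By translation invariance it suffices to
  describe the neighbourhoods of \<open>0\<close>.\<close>

definition is_strong_dual ::
    "('d::locally_convex_space \<Rightarrow> 's::locally_convex_space \<Rightarrow> real) \<Rightarrow> bool" where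
  "is_strong_dual pair \<longleftrightarrow>
     (\<forall>x. linear (\<lambda>d. pair d x)) \<and>
     bij_betw pair UNIV {f. linear f \<and> continuous_on UNIV f} \<and>
     (\<forall>P. eventually P (nhds 0) \<longleftrightarrow>
        (\<exists>B \<epsilon>. bounded_tvs B \<and> \<epsilon> > 0 \<and> (\<forall>d. (\<forall>x\<in>B. \<bar>pair d x\<bar> < \<epsilon>) \<longrightarrow> P d)))"

text \<open>\<open>'h\<close>, with the map \<open>\<kappa>\<close>, is the Hilbert space completion of \<open>'s\<close> for the inner product \<open>B\<close>.\<close>

definition hilbert_completion ::
    "('s::locally_convex_space \<Rightarrow> 's \<Rightarrow> real) \<Rightarrow> ('s \<Rightarrow> 'h::{real_inner,complete_space}) \<Rightarrow> bool" where
  "hilbert_completion B \<kappa> \<longleftrightarrow> linear \<kappa> \<and> continuous_on UNIV \<kappa> \<and> closure (range \<kappa>) = UNIV \<and>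
     (\<forall>x y. inner (\<kappa> x) (\<kappa> y) = B x y)"

text \<open>\<open>\<iota>\<close> embeds \<open>\<S>\<close> (type \<open>'s\<close>) in \<open>\<S>'\<close> (type \<open>'d\<close>), and \<open>j\<close> embeds \<open>\<S>\<close> in \<open>L\<^sub>2\<close> (type \<open>'l\<close>).
  The second use of \<open>is_strong_dual\<close> is the reflexivity of \<open>\<S>\<close>.\<close>

locale nuclear_triple =
  fixes pair :: "'d::locally_convex_space \<Rightarrow> 's::locally_convex_space \<Rightarrow> real"
    and \<iota> :: "'s \<Rightarrow> 'd"
    and j :: "'s \<Rightarrow> 'l::{real_inner,complete_space}"
  assumes nuclear_S: "complete_nuclear TYPE('s)"
    and nuclear_S': "complete_nuclear TYPE('d)"
    and strong_dual: "is_strong_dual pair"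
    and reflexive: "is_strong_dual (\<lambda>x d. pair d x)"
    and iota_linear: "linear \<iota>"
    and iota_inj: "inj \<iota>"
    and iota_continuous: "continuous_on UNIV \<iota>"
    and iota_dense: "closure (range \<iota>) = UNIV"
    and iota_sym: "pair (\<iota> x) y = pair (\<iota> y) x"
    and iota_pos: "x \<noteq> 0 \<Longrightarrow> pair (\<iota> x) x > 0"
    and L2_completion: "hilbert_completion (\<lambda>x y. pair (\<iota> x) y) j"

text \<open>The embedding of \<open>L\<^sub>2\<close>, identified with its own dual, in \<open>\<S>'\<close>.\<close>

definition L2_emb ::
    "('d \<Rightarrow> 's \<Rightarrow> real) \<Rightarrow> ('s \<Rightarrow> 'l::{real_inner,complete_space}) \<Rightarrow> 'l \<Rightarrow> 'd" where
  "L2_emb pair j w = inv pair (\<lambda>x. inner w (j x))"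


section \<open>Admissible operators\<close>

definition test_kernel :: "('d \<Rightarrow> 's \<Rightarrow> real) \<Rightarrow> nat \<Rightarrow> (nat \<Rightarrow> 'd) \<Rightarrow> 's set" where
  "test_kernel pair N0 p = {x. \<forall>n<N0. pair (p n) x = 0}"

text \<open>\<open>Lx\<close> is an extension of \<open>L\<close> to a subspace \<open>D\<close> of \<open>\<S>'\<close>. Only those elements of the extended
  domain are recorded whose image lies in \<open>L\<^sub>2\<close>; the null space is contained in this part.\<close>

definition is_operator_extension ::
    "('s \<Rightarrow> 'd::real_vector) \<Rightarrow> ('s \<Rightarrow> 'l::real_vector) \<Rightarrow> 'd set \<Rightarrow> ('d \<Rightarrow> 'l) \<Rightarrow> bool" where
  "is_operator_extension \<iota> L D Lx \<longleftrightarrow> subspace D \<and>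
     (\<forall>f\<in>D. \<forall>g\<in>D. Lx (f + g) = Lx f + Lx g) \<and> (\<forall>c. \<forall>f\<in>D. Lx (c *\<^sub>R f) = c *\<^sub>R Lx f) \<and>
     (\<forall>x. \<iota> x \<in> D \<and> Lx (\<iota> x) = L x)"

text \<open>\<open>Linv\<close> is \<open>L\<inverse>\<close>. It is a linear operator on some subspace of \<open>\<S>'\<close> on which the expressions
  below are meaningful; a linear map on a subspace extends to the whole space, so that \<open>Linv\<close>
  is total without loss of generality, and no continuity is required of it.\<close>

definition is_inverse_operator ::
    "('d \<Rightarrow> 's \<Rightarrow> real) \<Rightarrow> ('s \<Rightarrow> 'd::real_vector) \<Rightarrow> ('s \<Rightarrow> 'l::{real_inner,complete_space}) \<Rightarrow>
     ('s \<Rightarrow> 'l) \<Rightarrow> 'd set \<Rightarrow> ('d \<Rightarrow> 'l) \<Rightarrow> ('d \<Rightarrow> 'd) \<Rightarrow> bool" where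
  "is_inverse_operator pair \<iota> j L D Lx Linv \<longleftrightarrow> linear Linv \<and>
     (\<forall>x. Linv (L2_emb pair j (L x)) = \<iota> x) \<and>
     (\<forall>x. Linv (\<iota> x) \<in> D \<and> Lx (Linv (\<iota> x)) = j x)"

definition is_adjoint_on_test ::
    "('d \<Rightarrow> 's \<Rightarrow> real) \<Rightarrow> ('s \<Rightarrow> 'd) \<Rightarrow> ('d \<Rightarrow> 'd) \<Rightarrow> ('s \<Rightarrow> 'd) \<Rightarrow> bool" where
  "is_adjoint_on_test pair \<iota> T Tadj \<longleftrightarrow> (\<forall>x y. pair (Tadj x) y = pair (T (\<iota> y)) x)"

text \<open>\<open>A = (L\<^sup>*L)\<inverse>\<close> on \<open>\<S>\<close>: \<open>A (L\<^sup>*L x) = x\<close> whenever the functional \<open>L\<^sup>*L x\<close>, which maps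
  \<open>y\<close> to \<open>inner (L x) (L y)\<close>, is a test function \<open>z\<close>; and \<open>L\<^sup>*L (A x) = x\<close> whenever the extended
  \<open>L\<close> maps \<open>A x\<close> to \<open>L\<^sub>2\<close>.\<close>

definition is_gram_inverse ::
    "('d \<Rightarrow> 's \<Rightarrow> real) \<Rightarrow> ('s \<Rightarrow> 'd) \<Rightarrow> ('s \<Rightarrow> 'l::real_inner) \<Rightarrow> 'd set \<Rightarrow> ('d \<Rightarrow> 'l) \<Rightarrow>
     ('s \<Rightarrow> 'd) \<Rightarrow> bool" where
  "is_gram_inverse pair \<iota> L D Lx A \<longleftrightarrow>
     (\<forall>x z. (\<forall>y. pair (\<iota> z) y = inner (L x) (L y)) \<longrightarrow> A z = \<iota> x) \<and>
     (\<forall>x. A x \<in> D \<longrightarrow> (\<forall>y. inner (Lx (A x)) (L y) = pair (\<iota> x) y))"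

definition p_admissible ::
    "('d::locally_convex_space \<Rightarrow> 's::locally_convex_space \<Rightarrow> real) \<Rightarrow> ('s \<Rightarrow> 'd) \<Rightarrow>
     ('s \<Rightarrow> 'l::{real_inner,complete_space}) \<Rightarrow> nat \<Rightarrow> (nat \<Rightarrow> 'd) \<Rightarrow>
     ('s \<Rightarrow> 'l) \<Rightarrow> 'd set \<Rightarrow> ('d \<Rightarrow> 'l) \<Rightarrow> ('s \<Rightarrow> 'd) \<Rightarrow> bool" where
  "p_admissible pair \<iota> j N0 p L D Lx A \<longleftrightarrow>
     linear L \<and> is_operator_extension \<iota> L D Lx \<and>
     (\<exists>Linv Linvadj. is_inverse_operator pair \<iota> j L D Lx Linv \<and>
        is_adjoint_on_test pair \<iota> Linv Linvadj \<and> (\<forall>x. A x = Linv (Linvadj x))) \<and>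
     is_gram_inverse pair \<iota> L D Lx A \<and>
     continuous_on UNIV A \<and>
     (\<forall>x \<in> test_kernel pair N0 p - {0}. pair (A x) x > 0) \<and>
     span (p ` {..<N0}) \<subseteq> {f \<in> D. Lx f = 0}"


section \<open>The Hilbert space \<open>\<H>'\<close> and its predual, the native space\<close>

text \<open>\<open>\<H>'\<close> is the type \<open>'h\<close>, in which \<open>\<S>\<close> is embedded by \<open>\<kappa>\<close>. The native space consists of the
  functionals in \<open>\<S>'\<close> that are continuous in the norm of \<open>\<H>'\<close>; \<open>dual_ext\<close> is the duality product
  of the native space with \<open>\<H>'\<close>, extended by continuity from \<open>\<S>\<close>.\<close>

definition native ::
    "('d \<Rightarrow> 's \<Rightarrow> real) \<Rightarrow> ('s \<Rightarrow> 'h::real_normed_vector) \<Rightarrow> 'd set" where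
  "native pair \<kappa> = {f. \<exists>C. \<forall>x. \<bar>pair f x\<bar> \<le> C * norm (\<kappa> x)}"

definition dual_ext ::
    "('d \<Rightarrow> 's \<Rightarrow> real) \<Rightarrow> ('s \<Rightarrow> 'h::real_normed_vector) \<Rightarrow> 'd \<Rightarrow> 'h \<Rightarrow> real" where
  "dual_ext pair \<kappa> f = (THE g. bounded_linear g \<and> (\<forall>x. g (\<kappa> x) = pair f x))"

definition native_norm ::
    "('d \<Rightarrow> 's \<Rightarrow> real) \<Rightarrow> ('s \<Rightarrow> 'h::real_normed_vector) \<Rightarrow> 'd \<Rightarrow> real" where
  "native_norm pair \<kappa> f = onorm (dual_ext pair \<kappa> f)"

definition R_p ::
    "('d::real_vector \<Rightarrow> 's \<Rightarrow> real) \<Rightarrow> ('s \<Rightarrow> 'h::real_normed_vector) \<Rightarrow> nat \<Rightarrow> (nat \<Rightarrow> 'd) \<Rightarrow> 'h \<Rightarrow> 'd"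
  where "R_p pair \<kappa> N0 p u = (\<Sum>n<N0. dual_ext pair \<kappa> (p n) u *\<^sub>R p n)"

definition R_phi ::
    "('d \<Rightarrow> 's \<Rightarrow> real) \<Rightarrow> ('s \<Rightarrow> 'h::real_normed_vector) \<Rightarrow> nat \<Rightarrow> (nat \<Rightarrow> 'h) \<Rightarrow> 'd \<Rightarrow> 'h"
  where "R_phi pair \<kappa> N0 \<phi> f = (\<Sum>n<N0. dual_ext pair \<kappa> f (\<phi> n) *\<^sub>R \<phi> n)"

definition H_A ::
    "('d \<Rightarrow> 's \<Rightarrow> real) \<Rightarrow> ('s \<Rightarrow> 'h::real_normed_vector) \<Rightarrow> nat \<Rightarrow> (nat \<Rightarrow> 'd) \<Rightarrow> 'h set" where
  "H_A pair \<kappa> N0 p = {u. \<forall>n<N0. dual_ext pair \<kappa> (p n) u = 0}"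

definition H_A_dual ::
    "('d \<Rightarrow> 's \<Rightarrow> real) \<Rightarrow> ('s \<Rightarrow> 'h::real_normed_vector) \<Rightarrow> nat \<Rightarrow> (nat \<Rightarrow> 'h) \<Rightarrow> 'd set" where
  "H_A_dual pair \<kappa> N0 \<phi> = {f \<in> native pair \<kappa>. \<forall>n<N0. dual_ext pair \<kappa> f (\<phi> n) = 0}"

text \<open>\<open>a u v\<close> is the value of the product of \<open>A u\<close> and \<open>v\<close>, extended by continuity from test functions
  in \<open>\<S>\<^sub>p\<close> to \<open>H_A\<close>. The extension is needed because the \<open>\<phi> n\<close> need not be in \<open>\<S>\<close>.\<close>

definition is_gram_extension ::
    "('d \<Rightarrow> 's \<Rightarrow> real) \<Rightarrow> ('s \<Rightarrow> 'h::real_normed_vector) \<Rightarrow> nat \<Rightarrow> (nat \<Rightarrow> 'd) \<Rightarrow> ('s \<Rightarrow> 'd) \<Rightarrow>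
     ('h \<Rightarrow> 'h \<Rightarrow> real) \<Rightarrow> bool" where
  "is_gram_extension pair \<kappa> N0 p A a \<longleftrightarrow>
     continuous_on (H_A pair \<kappa> N0 p \<times> H_A pair \<kappa> N0 p) (\<lambda>(u, v). a u v) \<and>
     (\<forall>x \<in> test_kernel pair N0 p. \<forall>y \<in> test_kernel pair N0 p. a (\<kappa> x) (\<kappa> y) = pair (A x) y)"

text \<open>The bilinear form of \<open>A\<^sub>\<phi> = (Id - R\<^sub>p R\<^sub>\<phi>) A (Id - R\<^sub>\<phi> R\<^sub>p)\<close> on \<open>\<H>'\<close>: the right-hand factor maps
  \<open>\<H>'\<close> to \<open>H_A\<close>, and the left-hand factor is its adjoint.\<close>

definition A_phi ::
    "('d::real_vector \<Rightarrow> 's \<Rightarrow> real) \<Rightarrow> ('s \<Rightarrow> 'h::real_normed_vector) \<Rightarrow> nat \<Rightarrow> (nat \<Rightarrow> 'd) \<Rightarrow>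
     (nat \<Rightarrow> 'h) \<Rightarrow> ('h \<Rightarrow> 'h \<Rightarrow> real) \<Rightarrow> 'h \<Rightarrow> 'h \<Rightarrow> real" where
  "A_phi pair \<kappa> N0 p \<phi> a u v =
     a (u - R_phi pair \<kappa> N0 \<phi> (R_p pair \<kappa> N0 p u)) (v - R_phi pair \<kappa> N0 \<phi> (R_p pair \<kappa> N0 p v))"

text \<open>The adjoint \<open>L\<^sup>*\<close> from \<open>L\<^sub>2\<close> to \<open>\<H>'\<close> of the operator \<open>Lx\<close> from the native space to \<open>L\<^sub>2\<close>.\<close>

definition L_adjoint ::
    "('d \<Rightarrow> 's \<Rightarrow> real) \<Rightarrow> ('s \<Rightarrow> 'h::real_normed_vector) \<Rightarrow> ('d \<Rightarrow> 'l::real_inner) \<Rightarrow> 'l \<Rightarrow> 'h" where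
  "L_adjoint pair \<kappa> Lx w = (THE u. \<forall>f \<in> native pair \<kappa>. dual_ext pair \<kappa> f u = inner (Lx f) w)"

locale native_space = nuclear_triple pair \<iota> j
  for pair :: "'d::locally_convex_space \<Rightarrow> 's::locally_convex_space \<Rightarrow> real"
    and \<iota> :: "'s \<Rightarrow> 'd"
    and j :: "'s \<Rightarrow> 'l::{real_inner,complete_space}" +
  fixes N0 :: nat
    and p :: "nat \<Rightarrow> 'd"
    and L :: "'s \<Rightarrow> 'l"
    and D :: "'d set"
    and Lx :: "'d \<Rightarrow> 'l"
    and A :: "'s \<Rightarrow> 'd"
    and \<kappa> :: "'s \<Rightarrow> 'h::{real_inner,complete_space}"
    and \<phi> :: "nat \<Rightarrow> 'h"
    and a :: "'h \<Rightarrow> 'h \<Rightarrow> real"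
  assumes p_inj: "inj_on p {..<N0}"
    and p_independent: "independent (p ` {..<N0})"
    and admissible: "p_admissible pair \<iota> j N0 p L D Lx A"
    and p_native: "n < N0 \<Longrightarrow> p n \<in> native pair \<kappa>"
    and biorthogonal:
      "n < N0 \<Longrightarrow> m < N0 \<Longrightarrow> dual_ext pair \<kappa> (p n) (\<phi> m) = (if m = n then 1 else 0)"
    and gram_extension: "is_gram_extension pair \<kappa> N0 p A a"
    and H_completion:
      "hilbert_completion
         (\<lambda>x y. A_phi pair \<kappa> N0 p \<phi> a (\<kappa> x) (\<kappa> y) + dual_ext pair \<kappa> (R_p pair \<kappa> N0 p (\<kappa> x)) (\<kappa> y)) \<kappa>"
    and native_domain: "native pair \<kappa> \<subseteq> D"
    and L_bij: "bij_betw Lx (H_A_dual pair \<kappa> N0 \<phi>) UNIV"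
    and L_isometric: "f \<in> H_A_dual pair \<kappa> N0 \<phi> \<Longrightarrow> norm (Lx f) = native_norm pair \<kappa> f"


section \<open>Gaussian processes and conditional means\<close>

definition gaussian_rv :: "'w measure \<Rightarrow> ('w \<Rightarrow> real) \<Rightarrow> real \<Rightarrow> real \<Rightarrow> bool" where
  "gaussian_rv M X \<mu> v \<longleftrightarrow> X \<in> borel_measurable M \<and>
     (v = 0 \<and> (AE \<omega> in M. X \<omega> = \<mu>) \<or>
      v > 0 \<and> distributed M lborel X (\<lambda>t. ennreal (normal_density \<mu> (sqrt v) t)))"

text \<open>A random vector is Gaussian (possibly degenerate) with mean \<open>0\<close> and covariance matrix \<open>C\<close> iff
  every linear combination of its components is Gaussian with the corresponding variance.\<close>

definition centered_gaussian_process ::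
    "'w measure \<Rightarrow> ('i \<Rightarrow> 'w \<Rightarrow> real) \<Rightarrow> ('i \<Rightarrow> 'i \<Rightarrow> real) \<Rightarrow> bool" where
  "centered_gaussian_process M X C \<longleftrightarrow>
     (\<forall>(N::nat) (x :: nat \<Rightarrow> 'i) (t :: nat \<Rightarrow> real).
        gaussian_rv M (\<lambda>\<omega>. \<Sum>m<N. t m * X (x m) \<omega>) 0
          (\<Sum>m<N. \<Sum>n<N. t m * t n * C (x m) (x n)))"

text \<open>\<open>Gx\<close> extends the action of \<open>G\<close> from \<open>\<S>\<close> to \<open>\<H>'\<close> by density, as a mean-square limit.\<close>

definition extends_by_density ::
    "'w measure \<Rightarrow> ('d \<Rightarrow> 's \<Rightarrow> real) \<Rightarrow> ('s \<Rightarrow> 'h::real_normed_vector) \<Rightarrow> ('w \<Rightarrow> 'd) \<Rightarrow>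
     ('h \<Rightarrow> 'w \<Rightarrow> real) \<Rightarrow> bool" where
  "extends_by_density M pair \<kappa> G Gx \<longleftrightarrow>
     (\<forall>u. Gx u \<in> borel_measurable M \<and>
        (\<forall>x :: nat \<Rightarrow> 's. (\<lambda>k. \<kappa> (x k)) \<longlonglongrightarrow> u \<longrightarrow>
           (\<lambda>k. \<integral>\<^sup>+ \<omega>. ennreal ((pair (G \<omega>) (x k) - Gx u \<omega>)\<^sup>2) \<partial>M) \<longlonglongrightarrow> 0))"

text \<open>\<open>h\<close> is a version of \<open>y \<mapsto> E(X | Y = y)\<close>.\<close>

definition is_conditional_mean ::
    "'w measure \<Rightarrow> ('w \<Rightarrow> real ^ 'm) \<Rightarrow> ('w \<Rightarrow> real) \<Rightarrow> (real ^ 'm \<Rightarrow> real) \<Rightarrow> bool" where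
  "is_conditional_mean M Y X h \<longleftrightarrow> integrable M X \<and> h \<in> borel_measurable borel \<and>
     (AE \<omega> in M. real_cond_exp M (vimage_algebra (space M) Y borel) X \<omega> = h (Y \<omega>))"

definition is_mmse_estimator ::
    "'w measure \<Rightarrow> ('w \<Rightarrow> real ^ 'm) \<Rightarrow> ('w \<Rightarrow> real) \<Rightarrow> (real ^ 'm \<Rightarrow> real) \<Rightarrow> bool" where
  "is_mmse_estimator M Y X h \<longleftrightarrow> h \<in> borel_measurable borel \<and>
     (\<forall>h' \<in> borel_measurable borel.
        (\<integral>\<^sup>+ \<omega>. ennreal ((X \<omega> - h (Y \<omega>))\<^sup>2) \<partial>M) \<le> (\<integral>\<^sup>+ \<omega>. ennreal ((X \<omega> - h' (Y \<omega>))\<^sup>2) \<partial>M))"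

end

theory Submission
  imports Defs "HOL-Real_Asymp.Real_Asymp"
begin

text \<open>
  Both the spline interpolant and the conditional mean are governed by one orthogonal projection in
  the Hilbert space \<open>\<H>'\<close>.

  The inner product of \<open>\<H>'\<close> is the covariance form plus \<open>\<Sum>\<^sub>n \<langle>p\<^sub>n, u\<rangle> \<langle>p\<^sub>n, v\<rangle>\<close>. Together with
  biorthogonality this forces the \<open>\<phi>\<^sub>n\<close> to be an orthonormal family that represents the functionals
  \<open>p\<^sub>n\<close>, and it turns the covariance of the process into \<open>\<langle>P u, P v\<rangle>\<close>, where \<open>P\<close> is the orthogonal
  projection onto the complement \<open>H_A\<close> of the span of the \<open>\<phi>\<^sub>n\<close> (lemma \<open>A_phi_eq_inner\<close>). Dually, the
  energy \<open>norm (L f)\<close> of an element \<open>f\<close> of the native space is the norm of the functional \<open>f \<circ> P\<close>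
  (lemma \<open>norm_Lx\<close>).

  Let \<open>V\<close> be the span of the measurement functionals \<open>\<nu>\<^sub>m\<close>, which contains all \<open>\<phi>\<^sub>n\<close>. For given data
  \<open>y\<close> exactly one \<open>r\<close> in \<open>V\<close> satisfies \<open>\<langle>r, \<nu>\<^sub>m\<rangle> = y\<^sub>m\<close>. Any other interpolant differs from \<open>r\<close> by a
  functional that vanishes on \<open>V\<close>; this functional is carried by the complement of \<open>V\<close>, hence is
  unchanged by \<open>P\<close> and orthogonal to \<open>P r\<close>, so that by Pythagoras it strictly increases the energy
  (lemma \<open>spline_strictly_minimal\<close>). The spline is therefore \<open>g\<^sub>0 = \<langle>r, -\<rangle>\<close>.

  On the stochastic side, write \<open>u = w + \<Sum>\<^sub>m c\<^sub>m \<nu>\<^sub>m\<close> with \<open>w\<close> orthogonal to \<open>V\<close>. Since the \<open>\<phi>\<^sub>n\<close> lie in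
  \<open>V\<close>, \<open>P w = w\<close>, and \<open>P\<close> maps \<open>V\<close> to itself; so the Gaussian variable \<open>G(w)\<close> is uncorrelated with
  all \<open>G(\<nu>\<^sub>m)\<close>, and the conditional mean of \<open>G(u)\<close> is \<open>\<Sum>\<^sub>m c\<^sub>m y\<^sub>m\<close> (lemma \<open>regression_on_observations\<close>).
  But \<open>\<langle>r, u\<rangle> = \<Sum>\<^sub>m c\<^sub>m y\<^sub>m\<close> as well, because \<open>r\<close> is in \<open>V\<close>.

  That uncorrelated Gaussian variables have conditional mean zero is proved with characteristic
  functions: the joint law of \<open>(G(w), Y)\<close> is invariant under reversal of the sign of \<open>G(w)\<close>, so the
  signed measure of density \<open>G(w)\<close> has, as a measure on the data space, a vanishing Fourier
  transform; by uniqueness, which is reduced to the one-dimensional theorem of Levy one coordinate at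
  a time, it vanishes (lemma \<open>cond_exp_zero_if_reflection_symmetric\<close>).
\<close>

section \<open>Functionals and finite families in Hilbert spaces\<close>

text \<open>The Gram matrix of a linearly independent family is injective, hence invertible. It serves twice:
  it produces the representer of the spline from the data, and, with \<open>b\<close> the inner products of a
  vector with the \<open>\<nu> m\<close>, the coefficients of the orthogonal projection of that vector.\<close>

lemma gram_system_solvable:
  fixes \<nu> :: "'m::finite \<Rightarrow> 'h::real_inner"
  assumes "inj \<nu>" and "independent (range \<nu>)"
  shows "\<exists>c. \<forall>b :: real ^ 'm. \<forall>m. inner (\<Sum>k\<in>UNIV. c b $ k *\<^sub>R \<nu> k) (\<nu> m) = b $ m"
proof -
  define T :: "real ^ 'm \<Rightarrow> real ^ 'm"
    where "T c = (\<chi> m. inner (\<Sum>k\<in>UNIV. c $ k *\<^sub>R \<nu> k) (\<nu> m))" for c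
  have lin: "linear T"
    by (intro linearI)
      (simp_all add: T_def vec_eq_iff scaleR_add_left sum.distrib inner_add_left
        scaleR_sum_right[symmetric] scaleR_scaleR[symmetric] del: scaleR_scaleR)
  have "inj T"
  proof (rule linear_injective_0[OF lin, THEN iffD2], intro allI impI)
    fix c assume "T c = 0"
    let ?x = "\<Sum>k\<in>UNIV. c $ k *\<^sub>R \<nu> k"
    have "inner ?x (\<nu> m) = 0" for m
      using \<open>T c = 0\<close> by (simp add: T_def vec_eq_iff)
    then have "inner ?x ?x = 0"
      by (simp only: inner_sum_right inner_scaleR_right) simp
    then have "?x = 0" by simp
    also have "?x = (\<Sum>v\<in>range \<nu>. c $ (inv \<nu> v) *\<^sub>R v)"
      using assms(1) by (simp add: sum.reindex)
    finally have "c $ (inv \<nu> (\<nu> m)) = 0" for m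
      by (rule independentD[OF assms(2) _ subset_refl, rotated]) auto
    then show "c = 0" using assms(1) by (simp add: vec_eq_iff)
  qed
  then have "surj T" by (rule linear_inj_imp_surj[OF lin])
  then have "T (inv T b) = b" for b by (simp add: surj_f_inv_f)
  then show ?thesis by (intro exI[of _ "inv T"]) (simp add: T_def vec_eq_iff)
qed

text \<open>Although \<open>\<kappa>\<close> need not be injective, the bound makes \<open>f\<close> factor through it; the factor is Lipschitz
  and extends to the closure of the range. Linearity survives the passage to the limit.\<close>

lemma extend_bounded_functional_from_dense:
  fixes f :: "'s::real_vector \<Rightarrow> real" and \<kappa> :: "'s \<Rightarrow> 'h::real_normed_vector"
  assumes "linear f" and "linear \<kappa>" and dense: "closure (range \<kappa>) = UNIV"
    and C: "\<And>x. \<bar>f x\<bar> \<le> C * norm (\<kappa> x)"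
  obtains g where "bounded_linear g" and "\<And>x. g (\<kappa> x) = f x"
proof -
  interpret f: linear f by fact
  interpret \<kappa>: linear \<kappa> by fact
  define f' where "f' v = f (inv \<kappa> v)" for v
  have lip: "\<bar>f x - f y\<bar> \<le> C * norm (\<kappa> x - \<kappa> y)" for x y
    using C[of "x - y"] by (simp add: f.diff \<kappa>.diff)
  have f': "f' (\<kappa> x) = f x" for x
    using lip[of "inv \<kappa> (\<kappa> x)" x] by (simp add: f'_def f_inv_into_f)
  have lipschitz: "\<bar>C\<bar>-lipschitz_on (range \<kappa>) f'"
  proof (rule lipschitz_onI)
    fix v v' assume "v \<in> range \<kappa>" "v' \<in> range \<kappa>"
    then obtain x y where xy: "v = \<kappa> x" "v' = \<kappa> y" by auto
    have "\<bar>f x - f y\<bar> \<le> \<bar>C\<bar> * norm (\<kappa> x - \<kappa> y)"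
      using lip[of x y] by (rule order_trans) (intro mult_right_mono, auto)
    then show "dist (f' v) (f' v') \<le> \<bar>C\<bar> * dist v v'"
      by (simp add: xy f' dist_norm)
  qed simp
  obtain g where g: "\<bar>C\<bar>-lipschitz_on (closure (range \<kappa>)) g" "\<forall>v\<in>range \<kappa>. g v = f' v"
    using lipschitz_extend_closure[OF lipschitz] by blast
  then have cont: "continuous_on UNIV g"
    unfolding dense by (intro lipschitz_on_continuous_on)
  have g\<kappa>: "g (\<kappa> x) = f x" for x using g(2) by (simp add: f')
  have tend: "(\<lambda>n. g (u n)) \<longlonglongrightarrow> g v" if "u \<longlonglongrightarrow> v" for u v
  proof -
    have "isCont g v" using cont by (simp add: continuous_on_eq_continuous_at)
    then show ?thesis using that by (rule isCont_tendsto_compose)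
  qed
  have approx: "\<exists>x. (\<lambda>n. \<kappa> (x n)) \<longlonglongrightarrow> v" for v
  proof -
    have "v \<in> closure (range \<kappa>)" by (simp add: dense)
    then obtain u where "\<And>n. u n \<in> range \<kappa>" "u \<longlonglongrightarrow> v" by (auto simp: closure_sequential)
    then show ?thesis by (intro exI[of _ "\<lambda>n. inv \<kappa> (u n)"]) (simp add: f_inv_into_f)
  qed
  have add: "g (u + v) = g u + g v" for u v
  proof -
    obtain x y where xy: "(\<lambda>n. \<kappa> (x n)) \<longlonglongrightarrow> u" "(\<lambda>n. \<kappa> (y n)) \<longlonglongrightarrow> v" using approx by metis
    have "(\<lambda>n. g (\<kappa> (x n) + \<kappa> (y n))) \<longlonglongrightarrow> g (u + v)" by (intro tend tendsto_add xy)
    moreover have "g (\<kappa> (x n) + \<kappa> (y n)) = g (\<kappa> (x n)) + g (\<kappa> (y n))" for n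
      using g\<kappa>[of "x n + y n"] by (simp add: \<kappa>.add f.add g\<kappa>)
    ultimately show ?thesis
      using tendsto_add[OF tend[OF xy(1)] tend[OF xy(2)]] by (simp add: LIMSEQ_unique)
  qed
  have scale: "g (c *\<^sub>R u) = c * g u" for c u
  proof -
    obtain x where x: "(\<lambda>n. \<kappa> (x n)) \<longlonglongrightarrow> u" using approx by metis
    have "(\<lambda>n. g (c *\<^sub>R \<kappa> (x n))) \<longlonglongrightarrow> g (c *\<^sub>R u)" by (intro tend tendsto_scaleR x tendsto_const)
    moreover have "g (c *\<^sub>R \<kappa> (x n)) = c * g (\<kappa> (x n))" for n
      using g\<kappa>[of "c *\<^sub>R x n"] by (simp add: \<kappa>.scaleR f.scaleR g\<kappa>)
    ultimately show ?thesis
      using tendsto_mult_left[OF tend[OF x], of c] by (simp add: LIMSEQ_unique)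
  qed
  have bound: "\<bar>g u\<bar> \<le> norm u * C" for u
  proof -
    obtain x where x: "(\<lambda>n. \<kappa> (x n)) \<longlonglongrightarrow> u" using approx by metis
    show ?thesis
    proof (rule LIMSEQ_le)
      show "(\<lambda>n. \<bar>g (\<kappa> (x n))\<bar>) \<longlonglongrightarrow> \<bar>g u\<bar>" by (intro tendsto_rabs tend x)
      show "(\<lambda>n. norm (\<kappa> (x n)) * C) \<longlonglongrightarrow> norm u * C" by (intro tendsto_intros x)
    qed (use C in \<open>auto simp: g\<kappa> mult.commute\<close>)
  qed
  have "bounded_linear g"
    by (rule bounded_linear_intro[where K = C]) (auto simp: add scale bound)
  then show thesis using g\<kappa> by (rule that)
qed

lemma bounded_linear_eq_on_dense:
  fixes g h :: "'h::real_normed_vector \<Rightarrow> real"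
  assumes "bounded_linear g" "bounded_linear h" "closure (range \<kappa>) = UNIV"
    and "\<And>x. g (\<kappa> x) = h (\<kappa> x)"
  shows "g = h"
proof
  fix u
  have "(\<lambda>v. g v - h v) u = 0"
    by (rule continuous_constant_on_closure[where S = "range \<kappa>"])
      (use assms in \<open>auto intro!: linear_continuous_on bounded_linear_sub\<close>)
  then show "g u = h u" by simp
qed

section \<open>Geometry of the native space\<close>

context native_space
begin

abbreviation "dual \<equiv> dual_ext pair \<kappa>"

lemma \<kappa>_completion: "linear \<kappa>" "continuous_on UNIV \<kappa>" "closure (range \<kappa>) = UNIV"
  using H_completion by (auto simp: hilbert_completion_def)

lemma pair_linear_left: "linear (\<lambda>d. pair d x)"
  and pair_linear_right: "linear (pair d)"
  and pair_surj: "linear f \<Longrightarrow> continuous_on UNIV f \<Longrightarrow> \<exists>d. f = pair d"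
  and pair_inj: "pair d = pair e \<Longrightarrow> d = e"
proof -
  have bij: "bij_betw pair UNIV {f. linear f \<and> continuous_on UNIV f}"
    and "linear (\<lambda>d. pair d x)"
    using strong_dual by (auto simp: is_strong_dual_def)
  then show "linear (\<lambda>d. pair d x)" by simp
  have range: "range pair = {f. linear f \<and> continuous_on UNIV f}"
    using bij by (simp add: bij_betw_def)
  then show "linear (pair d)" by blast
  show "\<exists>d. f = pair d" if "linear f" "continuous_on UNIV f"
    using range that by blast
  show "pair d = pair e \<Longrightarrow> d = e"
    using bij by (auto simp: bij_betw_def dest: injD)
qed

text \<open>The definite description in the definition of the extended duality product is legitimate: the
  extension exists by boundedness, and it is unique since \<open>\<S>\<close> is dense in \<open>\<H>'\<close>.\<close>

lemma dual_bounded_linear: "bounded_linear (dual f)"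
  and dual_\<kappa>: "dual f (\<kappa> x) = pair f x" if f: "f \<in> native pair \<kappa>"
proof -
  obtain C where "\<And>x. \<bar>pair f x\<bar> \<le> C * norm (\<kappa> x)"
    using f unfolding native_def by blast
  then obtain g where g: "bounded_linear g" "\<And>x. g (\<kappa> x) = pair f x"
    using extend_bounded_functional_from_dense[OF pair_linear_right \<kappa>_completion(1,3)] by metis
  have "bounded_linear (dual f) \<and> (\<forall>x. dual f (\<kappa> x) = pair f x)"
    unfolding dual_ext_def
  proof (rule theI[of "\<lambda>g. bounded_linear g \<and> (\<forall>x. g (\<kappa> x) = pair f x)" g])
    show "h = g" if "bounded_linear h \<and> (\<forall>x. h (\<kappa> x) = pair f x)" for h
      using that g by (intro bounded_linear_eq_on_dense[OF _ _ \<kappa>_completion(3)]) auto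
  qed (use g in auto)
  then show "bounded_linear (dual f)" "dual f (\<kappa> x) = pair f x" by auto
qed

lemma dual_eqI:
  assumes "bounded_linear g" "\<And>x. g (\<kappa> x) = pair f x"
  shows "f \<in> native pair \<kappa>" and "dual f = g"
proof -
  obtain K where "\<And>v. \<bar>g v\<bar> \<le> norm v * K"
    using bounded_linear.bounded[OF assms(1)] by auto
  then have "\<bar>pair f x\<bar> \<le> K * norm (\<kappa> x)" for x
    by (simp add: assms(2)[symmetric] mult.commute)
  then show f: "f \<in> native pair \<kappa>"
    unfolding native_def by blast
  show "dual f = g"
    by (rule bounded_linear_eq_on_dense[OF dual_bounded_linear[OF f] assms(1) \<kappa>_completion(3)])
      (simp add: assms(2) dual_\<kappa>[OF f])
qed

text \<open>A continuous functional on \<open>\<H>'\<close> restricts to a continuous functional on \<open>\<S>\<close>, so it comes from an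
  element of \<open>\<S>'\<close>. The native space is thus the whole dual of \<open>\<H>'\<close>.\<close>

lemma dual_surj:
  assumes "bounded_linear g"
  obtains f where "f \<in> native pair \<kappa>" "dual f = g"
proof -
  interpret bounded_linear g by fact
  have "linear (g \<circ> \<kappa>)"
    by (rule linear_compose[OF \<kappa>_completion(1) linear_axioms])
  moreover have "continuous_on UNIV (g \<circ> \<kappa>)"
    using \<kappa>_completion(2) by (intro continuous_on_compose linear_continuous_on assms)
  ultimately obtain f where f: "g \<circ> \<kappa> = pair f" using pair_surj by metis
  then have "g (\<kappa> x) = pair f x" for x by (metis comp_apply)
  then show thesis using dual_eqI[OF assms, of f] that by blast
qed

lemma dual_inj:
  assumes "f \<in> native pair \<kappa>" "g \<in> native pair \<kappa>" "dual f = dual g"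
  shows "f = g"
proof (rule pair_inj, rule ext)
  show "pair f x = pair g x" for x
    using dual_\<kappa>[OF assms(1), of x] dual_\<kappa>[OF assms(2), of x] assms(3) by simp
qed

lemma native_add: "f + g \<in> native pair \<kappa>" "dual (f + g) = (\<lambda>u. dual f u + dual g u)"
  if "f \<in> native pair \<kappa>" "g \<in> native pair \<kappa>"
  using dual_eqI[of "\<lambda>u. dual f u + dual g u" "f + g"] that
  by (auto simp: dual_\<kappa> linear_add[OF pair_linear_left] intro!: bounded_linear_add dual_bounded_linear)

lemma native_scale: "c *\<^sub>R f \<in> native pair \<kappa>" "dual (c *\<^sub>R f) = (\<lambda>u. c * dual f u)"
  if "f \<in> native pair \<kappa>"
  using dual_eqI[of "\<lambda>u. c * dual f u" "c *\<^sub>R f"] that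
    bounded_linear_const_mult[OF dual_bounded_linear[OF that], of c]
  by (auto simp: dual_\<kappa> linear_scale[OF pair_linear_left])

lemma native_zero: "0 \<in> native pair \<kappa>" "dual 0 = (\<lambda>u. 0)"
  using dual_eqI[of "\<lambda>u. 0" 0] by (auto simp: linear_0[OF pair_linear_left])

lemma native_combination:
  "(\<Sum>n<k. c n *\<^sub>R p n) \<in> native pair \<kappa> \<and> dual (\<Sum>n<k. c n *\<^sub>R p n) = (\<lambda>u. \<Sum>n<k. c n * dual (p n) u)"
  if "k \<le> N0"
  using that by (induction k) (auto simp: native_zero native_add native_scale p_native)

text \<open>This is \<open>Id - R\<^sub>\<phi> R\<^sub>p\<close>. It turns out to be the orthogonal projection of \<open>\<H>'\<close> onto \<open>H_A\<close>.\<close>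

definition proj_A :: "'h \<Rightarrow> 'h" where
  "proj_A u = u - (\<Sum>n<N0. dual (p n) u *\<^sub>R \<phi> n)"

lemma R_phi_R_p: "R_phi pair \<kappa> N0 \<phi> (R_p pair \<kappa> N0 p u) = (\<Sum>n<N0. dual (p n) u *\<^sub>R \<phi> n)"
  using native_combination[of N0 "\<lambda>n. dual (p n) u"]
  by (simp add: R_phi_def R_p_def biorthogonal if_distrib[of "\<lambda>x. _ * x"] cong: if_cong)

lemma dual_p_R: "dual (R_p pair \<kappa> N0 p u) v = (\<Sum>n<N0. dual (p n) u * dual (p n) v)"
  using native_combination[of N0 "\<lambda>n. dual (p n) u"] by (simp add: R_p_def)

lemma A_phi_eq: "A_phi pair \<kappa> N0 p \<phi> a u v = a (proj_A u) (proj_A v)"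
  by (simp add: A_phi_def R_phi_R_p proj_A_def)

lemma linear_dual_p: "n < N0 \<Longrightarrow> bounded_linear (dual (p n))"
  by (simp add: dual_bounded_linear p_native)

lemma bounded_linear_proj_A: "bounded_linear proj_A"
  unfolding proj_A_def
  by (intro bounded_linear_sub bounded_linear_ident bounded_linear_sum
      bounded_linear_compose[OF bounded_linear_scaleR_left linear_dual_p]) auto

lemma dual_p_proj_A: "n < N0 \<Longrightarrow> dual (p n) (proj_A u) = 0"
  using linear_dual_p[of n]
  by (simp add: proj_A_def bounded_linear.linear linear_diff linear_sum linear_scale biorthogonal
     if_distrib[of "\<lambda>x. _ * x"] cong: if_cong)

lemma proj_A_in_H_A: "proj_A u \<in> H_A pair \<kappa> N0 p"
  by (simp add: H_A_def dual_p_proj_A)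

text \<open>On the image of \<open>\<S>\<close> this is the definition of the inner product of \<open>\<H>'\<close>. Both sides are continuous
  on \<open>\<H>' \<times> \<H>'\<close>, where pairs of test functions are dense.\<close>

lemma inner_eq: "inner u v = a (proj_A u) (proj_A v) + (\<Sum>n<N0. dual (p n) u * dual (p n) v)"
proof -
  have contP: "continuous_on UNIV proj_A"
    by (rule linear_continuous_on[OF bounded_linear_proj_A])
  have "continuous_on UNIV (\<lambda>w. (proj_A (fst w), proj_A (snd w)))"
    by (intro continuous_on_Pair continuous_on_compose2[OF contP] continuous_intros) auto
  moreover have "continuous_on (H_A pair \<kappa> N0 p \<times> H_A pair \<kappa> N0 p) (\<lambda>(u, v). a u v)"
    using gram_extension by (simp add: is_gram_extension_def)
  ultimately have c1: "continuous_on UNIV (\<lambda>w. a (proj_A (fst w)) (proj_A (snd w)))"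
    using continuous_on_compose2[of _ "\<lambda>(u, v). a u v" UNIV "\<lambda>w. (proj_A (fst w), proj_A (snd w))"]
    by (force simp: proj_A_in_H_A)
  have c2: "continuous_on UNIV (\<lambda>w. dual (p n) (fst w))" "continuous_on UNIV (\<lambda>w. dual (p n) (snd w))"
    if "n < N0" for n
    by (rule continuous_on_compose2[OF linear_continuous_on[OF linear_dual_p[OF that], of UNIV]];
      simp add: continuous_intros)+
  have dense: "closure (range \<kappa> \<times> range \<kappa>) = UNIV"
    by (simp add: closure_Times \<kappa>_completion(3))
  define d where "d w = inner (fst w) (snd w) - (a (proj_A (fst w)) (proj_A (snd w)) +
        (\<Sum>n<N0. dual (p n) (fst w) * dual (p n) (snd w)))" for w
  have cont_d: "continuous_on UNIV d"
    unfolding d_def by (intro continuous_intros c1 c2) auto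
  have "d (u, v) = 0"
  proof (rule continuous_constant_on_closure[where S = "range \<kappa> \<times> range \<kappa>"])
    fix w assume "w \<in> range \<kappa> \<times> range \<kappa>"
    then obtain x y where w: "w = (\<kappa> x, \<kappa> y)" by auto
    have "inner (\<kappa> x) (\<kappa> y) = A_phi pair \<kappa> N0 p \<phi> a (\<kappa> x) (\<kappa> y) + dual (R_p pair \<kappa> N0 p (\<kappa> x)) (\<kappa> y)"
      using H_completion by (simp add: hilbert_completion_def)
    then show "d w = 0"
      by (simp add: w d_def A_phi_eq dual_p_R)
  qed (use cont_d dense in auto)
  then show ?thesis by (simp add: d_def)
qed

lemma proj_A_of_H_A: "(\<And>n. n < N0 \<Longrightarrow> dual (p n) u = 0) \<Longrightarrow> proj_A u = u"
  by (simp add: proj_A_def)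

lemma proj_A_proj_A: "proj_A (proj_A u) = proj_A u"
  by (rule proj_A_of_H_A) (rule dual_p_proj_A)

text \<open>On \<open>H_A\<close> the \<open>p n\<close> vanish, so the extended Gram form is the inner product there. Hence the
  covariance of the process is the inner product of the projections.\<close>

lemma A_phi_eq_inner: "A_phi pair \<kappa> N0 p \<phi> a u v = inner (proj_A u) (proj_A v)"
  by (simp add: A_phi_eq inner_eq[of "proj_A u"] proj_A_proj_A dual_p_proj_A)

lemma proj_A_\<phi>: "n < N0 \<Longrightarrow> proj_A (\<phi> n) = 0"
  by (simp add: proj_A_def biorthogonal if_distrib[of "\<lambda>x. x *\<^sub>R _"] cong: if_cong)

text \<open>The \<open>\<phi> n\<close> are annihilated by the projection, so that only the finite-rank part of the inner
  product sees them.\<close>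

lemma dual_p_eq_inner: "dual (p n) u = inner (\<phi> n) u" if "n < N0"
proof -
  have "inner (\<phi> n) u = inner (proj_A (\<phi> n)) (proj_A u) + (\<Sum>m<N0. dual (p m) (\<phi> n) * dual (p m) u)"
    using inner_eq[of "\<phi> n" u] by (simp add: A_phi_eq_inner[unfolded A_phi_eq])
  also have "\<dots> = (\<Sum>m<N0. if n = m then dual (p m) u else 0)"
    using that by (simp add: proj_A_\<phi> biorthogonal if_distrib[of "\<lambda>x. x * _"] cong: if_cong)
  finally show ?thesis using that by simp
qed

text \<open>The \<open>\<phi> n\<close> are orthogonal to \<open>H_A\<close>, so only the component of \<open>v\<close> in \<open>H_A\<close> contributes.\<close>

lemma inner_proj_A_left: "inner (proj_A u) v = inner (proj_A u) (proj_A v)"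
  using inner_eq[of "proj_A u" v] A_phi_eq_inner[of "proj_A u" v]
  by (simp add: A_phi_eq proj_A_proj_A dual_p_proj_A)

lemma proj_A_eq_self_if_orthogonal: "(\<And>n. n < N0 \<Longrightarrow> inner (\<phi> n) u = 0) \<Longrightarrow> proj_A u = u"
  by (simp add: proj_A_of_H_A dual_p_eq_inner)

text \<open>Subtracting from \<open>f\<close> its component in the span of the \<open>p n\<close> changes neither side: \<open>Lx\<close> vanishes on
  that span. What remains lies in the space on which \<open>Lx\<close> is an isometry, and its functional is
  the composition of that of \<open>f\<close> with the projection.\<close>

lemma norm_Lx:
  assumes f: "f \<in> native pair \<kappa>"
  shows "norm (Lx f) = onorm (\<lambda>u. dual f (proj_A u))"
proof -
  have ext: "is_operator_extension \<iota> L D Lx" and null: "span (p ` {..<N0}) \<subseteq> {f \<in> D. Lx f = 0}"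
    using admissible by (auto simp: p_admissible_def)
  define q where "q = (\<Sum>n<N0. (- dual f (\<phi> n)) *\<^sub>R p n)"
  have q: "q \<in> native pair \<kappa>" "dual q u = - (\<Sum>n<N0. dual f (\<phi> n) * dual (p n) u)" for u
    using native_combination[of N0 "\<lambda>n. - dual f (\<phi> n)"] by (simp_all add: q_def sum_negf)
  have "q \<in> span (p ` {..<N0})"
    unfolding q_def by (intro span_sum span_scale span_base) auto
  then have "q \<in> D" "Lx q = 0" using null by auto
  then have "Lx (f + q) = Lx f"
    using ext f native_domain by (auto simp: is_operator_extension_def)
  have dual_fq: "dual (f + q) = (\<lambda>u. dual f (proj_A u))"
  proof
    fix u
    have "linear (dual f)" using dual_bounded_linear[OF f] by (rule bounded_linear.linear)
    then show "dual (f + q) u = dual f (proj_A u)"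
      by (simp add: native_add f q proj_A_def linear_diff linear_sum linear_scale mult.commute)
  qed
  have "f + q \<in> H_A_dual pair \<kappa> N0 \<phi>"
    using dual_bounded_linear[OF f]
    by (simp add: H_A_dual_def native_add f q(1) dual_fq proj_A_\<phi> bounded_linear.linear linear_0)
  then show ?thesis
    using L_isometric[of "f + q"] \<open>Lx (f + q) = Lx f\<close> dual_fq by (simp add: native_norm_def)
qed

text \<open>The uniqueness and the minimality of the spline. The competitor \<open>g\<close> is \<open>\<langle>r, -\<rangle> + w\<close> with \<open>w \<noteq> 0\<close>
  vanishing on the span of the measurements, so \<open>w v \<noteq> 0\<close> for some \<open>v\<close> orthogonal to that span.
  Testing the functional \<open>g \<circ> P\<close> on the vector \<open>z = P r + t v\<close> bounds its norm from below
  by \<open>norm z\<close>, which exceeds \<open>norm (P r)\<close>.\<close>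

lemma spline_strictly_minimal:
  fixes \<nu> :: "'m::finite \<Rightarrow> 'h"
  assumes \<phi>_span: "span (\<phi> ` {..<N0}) \<subseteq> span (range \<nu>)"
    and project: "\<And>u. \<exists>c :: real ^ 'm. \<forall>m. inner (u - (\<Sum>k\<in>UNIV. c $ k *\<^sub>R \<nu> k)) (\<nu> m) = 0"
    and r: "r \<in> span (range \<nu>)" "\<And>u. dual g0 u = inner r u" "g0 \<in> native pair \<kappa>"
    and g: "g \<in> native pair \<kappa>" "\<And>m. dual g (\<nu> m) = dual g0 (\<nu> m)" "g \<noteq> g0"
  shows "norm (Lx g0) < norm (Lx g)"
proof -
  define w where "w u = dual g u - inner r u" for u
  have w: "bounded_linear w"
    unfolding w_def by (intro bounded_linear_sub dual_bounded_linear g bounded_linear_inner_right)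
  have lin_w: "linear w" using w by (rule bounded_linear.linear)
  have w_span: "w u = 0" if "u \<in> span (range \<nu>)" for u
    using that by (rule linear_eq_0_on_span[OF lin_w, rotated]) (auto simp: w_def g(2) r(2))
  have "dual g \<noteq> dual g0" using dual_inj[OF g(1) r(3)] g(3) by blast
  then obtain u where "dual g u \<noteq> dual g0 u" by blast
  then have "w u \<noteq> 0" by (simp add: w_def r(2))
  obtain c :: "real ^ 'm" where c: "\<forall>m. inner (u - (\<Sum>k\<in>UNIV. c $ k *\<^sub>R \<nu> k)) (\<nu> m) = 0"
    using project[of u] by blast
  define v where "v = u - (\<Sum>k\<in>UNIV. c $ k *\<^sub>R \<nu> k)"
  have v_orth: "inner v x = 0" if "x \<in> span (range \<nu>)" for x
    using bounded_linear.linear[OF bounded_linear_inner_right] _ that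
  proof (rule linear_eq_0_on_span)
    show "inner v y = 0" if "y \<in> range \<nu>" for y using c that by (auto simp: v_def)
  qed
  have "w v = w u"
    unfolding v_def linear_diff[OF lin_w]
    by (simp, intro w_span span_sum span_scale span_base) auto
  then have "w v \<noteq> 0" using \<open>w u \<noteq> 0\<close> by simp
  then have "v \<noteq> 0" using linear_0[OF lin_w] by auto
  have \<phi>: "\<phi> n \<in> span (range \<nu>)" if "n < N0" for n
    using \<phi>_span span_base[of "\<phi> n" "\<phi> ` {..<N0}"] that by blast
  have Prv: "proj_A v = v"
    using v_orth \<phi> by (intro proj_A_eq_self_if_orthogonal) (simp add: inner_commute[of _ v])
  \<comment> \<open>With this \<open>t\<close>, \<open>t * w v = norm (t *\<^sub>R v) ^ 2\<close>, so that \<open>g\<close> takes the value \<open>norm z ^ 2\<close> at \<open>z\<close>.\<close>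
  define t where "t = w v / (norm v)\<^sup>2"
  define z where "z = proj_A r + t *\<^sub>R v"
  have "proj_A r \<in> span (range \<nu>)"
    unfolding proj_A_def using \<phi> by (intro span_diff r(1) span_sum span_scale) auto
  then have rv: "inner (proj_A r) v = 0" "w (proj_A r) = 0"
    using v_orth w_span by (simp_all add: inner_commute[of _ v])
  have "norm z ^ 2 = norm (proj_A r) ^ 2 + t\<^sup>2 * norm v ^ 2"
    using rv(1) inner_commute[of v "proj_A r"] unfolding z_def power2_norm_eq_inner
    by (simp add: inner_add_left inner_add_right power2_eq_square)
  have Prz: "proj_A z = z"
    using bounded_linear.linear[OF bounded_linear_proj_A]
    by (simp add: z_def linear_add linear_scale proj_A_proj_A Prv)
  have "dual g (proj_A z) = inner r z + w z" by (simp add: Prz w_def)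
  also have "inner r z = inner (proj_A r) z"
    using inner_proj_A_left[of z r] inner_proj_A_left[of r z] by (simp add: Prz inner_commute)
  also have "w z = t * w v"
    by (simp add: z_def linear_add[OF lin_w] linear_scale[OF lin_w] rv)
  also have "t * w v = t\<^sup>2 * norm v ^ 2"
    using \<open>v \<noteq> 0\<close> by (simp add: t_def power2_eq_square)
  also have "inner (proj_A r) z = norm (proj_A r) ^ 2"
    by (simp add: z_def inner_add_right rv power2_norm_eq_inner)
  finally have val: "dual g (proj_A z) = norm z ^ 2"
    using \<open>norm z ^ 2 = _\<close> by simp
  have "norm (proj_A r) ^ 2 < norm z ^ 2"
    using \<open>norm z ^ 2 = _\<close> \<open>v \<noteq> 0\<close> \<open>w v \<noteq> 0\<close> by (simp add: t_def)
  then have less: "norm (proj_A r) < norm z" by (simp add: power2_less_imp_less)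
  then have "norm z > 0" using norm_ge_zero[of "proj_A r"] by linarith
  have "bounded_linear (\<lambda>u. dual g (proj_A u))"
    by (rule bounded_linear_compose[OF dual_bounded_linear[OF g(1)] bounded_linear_proj_A])
  then have "norm (dual g (proj_A z)) \<le> onorm (\<lambda>u. dual g (proj_A u)) * norm z"
    by (rule onorm)
  then have "norm z \<le> onorm (\<lambda>u. dual g (proj_A u))"
    using val \<open>norm z > 0\<close> by (simp add: power2_eq_square)
  moreover have "onorm (\<lambda>u. dual g0 (proj_A u)) \<le> norm (proj_A r)"
  proof (rule onorm_bound)
    fix u
    have "dual g0 (proj_A u) = inner (proj_A r) u"
      using inner_proj_A_left[of u r] inner_proj_A_left[of r u] by (simp add: r(2) inner_commute)
    then show "norm (dual g0 (proj_A u)) \<le> norm (proj_A r) * norm u"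
      by (simp add: Cauchy_Schwarz_ineq2)
  qed simp
  ultimately show ?thesis
    using less by (simp add: norm_Lx[OF g(1)] norm_Lx[OF r(3)])
qed

end

section \<open>Vanishing of complex measures with zero Fourier transform\<close>

text \<open>The positive and the negative part of \<open>W\<close> have the same mass (take \<open>t = 0\<close>). After normalisation
  they induce two probability distributions of \<open>Y\<close> with the same characteristic function.\<close>

lemma integral_indicator_zero_if_fourier_zero_real:
  fixes W Y :: "'w \<Rightarrow> real"
  assumes W: "integrable M W" and Y[measurable]: "Y \<in> borel_measurable M"
    and fourier: "\<And>t. (\<integral>\<omega>. W \<omega> *\<^sub>R iexp (t * Y \<omega>) \<partial>M) = 0"
    and B[measurable]: "B \<in> sets borel"
  shows "(\<integral>\<omega>. W \<omega> * indicator B (Y \<omega>) \<partial>M) = 0"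
proof -
  have Wm[measurable]: "W \<in> borel_measurable M" using W by simp
  define Wp where "Wp = (\<lambda>\<omega>. max (W \<omega>) 0)"
  define Wn where "Wn = (\<lambda>\<omega>. max (- W \<omega>) 0)"
  have int_p: "integrable M Wp" and int_n: "integrable M Wn"
    using W by (auto simp: Wp_def Wn_def intro!: Bochner_Integration.integrable_max)
  have m[measurable]: "Wp \<in> borel_measurable M" "Wn \<in> borel_measurable M"
    by (simp_all add: Wp_def Wn_def)
  have pos: "Wp \<omega> \<ge> 0" "Wn \<omega> \<ge> 0" for \<omega> by (auto simp: Wp_def Wn_def)
  have W_eq: "W \<omega> = Wp \<omega> - Wn \<omega>" for \<omega> by (auto simp: Wp_def Wn_def)
  define c where "c = integral\<^sup>L M Wp"
  have mass: "integral\<^sup>L M Wn = c"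
  proof -
    have "complex_of_real (\<integral>\<omega>. W \<omega> \<partial>M) = 0"
      using fourier[of 0] by (simp add: scaleR_conv_of_real)
    then show ?thesis using int_p int_n by (simp add: W_eq c_def)
  qed
  have twisted: "integrable M (\<lambda>\<omega>. f \<omega> *\<^sub>R iexp (t * Y \<omega>))"
    if "integrable M f" for f :: "'w \<Rightarrow> real" and t
  proof -
    have [measurable]: "f \<in> borel_measurable M" using that by simp
    show ?thesis using that by (rule Bochner_Integration.integrable_bound) auto
  qed
  have cut: "integrable M (\<lambda>\<omega>. f \<omega> * indicator B (Y \<omega>))"
    if "integrable M f" for f :: "'w \<Rightarrow> real"
  proof -
    have [measurable]: "f \<in> borel_measurable M" using that by simp
    show ?thesis
      using that by (rule Bochner_Integration.integrable_bound) (auto simp: indicator_def)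
  qed
  show ?thesis
  proof (cases "c = 0")
    case True
    have "AE \<omega> in M. Wp \<omega> = 0" "AE \<omega> in M. Wn \<omega> = 0"
      using integral_nonneg_eq_0_iff_AE[OF int_p] integral_nonneg_eq_0_iff_AE[OF int_n]
      True mass pos by (auto simp: c_def)
    then have "AE \<omega> in M. W \<omega> * indicator B (Y \<omega>) = 0"
      by eventually_elim (simp add: W_eq)
    then show ?thesis by (rule integral_eq_zero_AE)
  next
    case False
    then have "c > 0" using pos by (simp add: c_def less_le)
    define law where "law f = distr (density M (\<lambda>\<omega>. ennreal (f \<omega> / c))) borel Y" for f
    have law: "real_distribution (law f)" "char (law f) t = (\<integral>\<omega>. f \<omega> *\<^sub>R iexp (t * Y \<omega>) \<partial>M) / c"
      "measure (law f) B = (\<integral>\<omega>. f \<omega> * indicator B (Y \<omega>) \<partial>M) / c"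
      if f: "integrable M f" "\<And>\<omega>. f \<omega> \<ge> 0" "integral\<^sup>L M f = c" for f t
    proof -
      have [measurable]: "f \<in> borel_measurable M" using f(1) by simp
      have "(\<integral>\<^sup>+\<omega>. ennreal (f \<omega> / c) \<partial>M) = ennreal (\<integral>\<omega>. f \<omega> / c \<partial>M)"
        using f \<open>c > 0\<close> by (intro nn_integral_eq_integral) auto
      also have "\<dots> = 1" using f \<open>c > 0\<close> by simp
      finally have "emeasure (density M (\<lambda>\<omega>. ennreal (f \<omega> / c))) (space M) = 1"
        by (subst emeasure_density) (auto simp: nn_integral_set_ennreal cong: nn_integral_cong)
      then have "prob_space (density M (\<lambda>\<omega>. ennreal (f \<omega> / c)))"
        by (intro prob_spaceI) simp
      then have ps: "prob_space (law f)"
        unfolding law_def by (rule prob_space.prob_space_distr) simp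
      then show "real_distribution (law f)"
        by (simp add: real_distribution_def real_distribution_axioms_def law_def)
      show "char (law f) t = (\<integral>\<omega>. f \<omega> *\<^sub>R iexp (t * Y \<omega>) \<partial>M) / c"
      proof -
        have "char (law f) t = (\<integral>\<omega>. (f \<omega> / c) *\<^sub>R iexp (t * Y \<omega>) \<partial>M)"
          unfolding char_def law_def using f \<open>c > 0\<close>
          by (subst integral_distr, simp, measurable, subst integral_density) auto
        also have "\<dots> = (\<integral>\<omega>. (f \<omega> *\<^sub>R iexp (t * Y \<omega>)) / complex_of_real c \<partial>M)"
          by (intro Bochner_Integration.integral_cong) (auto simp: scaleR_conv_of_real)
        finally show ?thesis by simp
      qed
      interpret law: prob_space "law f" by (rule ps)
      have "measure (law f) B = (\<integral>x. indicator B x \<partial>law f)"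
        by (simp add: law_def)
      also have "\<dots> = (\<integral>\<omega>. (f \<omega> / c) *\<^sub>R indicator B (Y \<omega>) \<partial>M)"
        unfolding law_def using f \<open>c > 0\<close>
        by (subst integral_distr, simp, measurable, subst integral_density) auto
      also have "\<dots> = (\<integral>\<omega>. (f \<omega> * indicator B (Y \<omega>)) / c \<partial>M)" by simp
      finally show "measure (law f) B = (\<integral>\<omega>. f \<omega> * indicator B (Y \<omega>) \<partial>M) / c"
        by (simp only: Bochner_Integration.integral_divide_zero)
    qed
    have "char (law Wp) t = char (law Wn) t" for t
    proof -
      have "(\<integral>\<omega>. Wp \<omega> *\<^sub>R iexp (t * Y \<omega>) \<partial>M) - (\<integral>\<omega>. Wn \<omega> *\<^sub>R iexp (t * Y \<omega>) \<partial>M) = 0"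
        using fourier[of t] twisted[OF int_p, of t] twisted[OF int_n, of t]
        by (simp add: W_eq algebra_simps)
      then show ?thesis
        using law(2)[OF int_p pos(1)] law(2)[OF int_n pos(2)] mass c_def by simp
    qed
    then have "law Wp = law Wn"
      using law(1)[OF int_p pos(1)] law(1)[OF int_n pos(2)] mass c_def
      by (intro Levy_uniqueness) auto
    then have "(\<integral>\<omega>. Wp \<omega> * indicator B (Y \<omega>) \<partial>M) = (\<integral>\<omega>. Wn \<omega> * indicator B (Y \<omega>) \<partial>M)"
      using law(3)[OF int_p pos(1)] law(3)[OF int_n pos(2)] mass c_def \<open>c > 0\<close> by simp
    then show ?thesis
      using cut[OF int_p] cut[OF int_n] by (simp add: W_eq algebra_simps)
  qed
qed

text \<open>The real and the imaginary part inherit the hypothesis, since conjugating \<open>W\<close> amounts to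
  conjugating the integral at \<open>- t\<close>. Complex weights are what the induction over the coordinates
  needs.\<close>

lemma integral_indicator_zero_if_fourier_zero:
  fixes W :: "'w \<Rightarrow> complex" and Y :: "'w \<Rightarrow> real"
  assumes W: "integrable M W" and Y[measurable]: "Y \<in> borel_measurable M"
    and fourier: "\<And>t. (\<integral>\<omega>. W \<omega> * iexp (t * Y \<omega>) \<partial>M) = 0"
    and B[measurable]: "B \<in> sets borel"
  shows "(\<integral>\<omega>. W \<omega> * indicator B (Y \<omega>) \<partial>M) = 0"
proof -
  have Wm[measurable]: "W \<in> borel_measurable M" using W by simp
  have int1: "integrable M (\<lambda>\<omega>. W \<omega> * iexp (t * Y \<omega>))" for t
    using W by (rule Bochner_Integration.integrable_bound) (auto simp: norm_mult)
  have [measurable]: "(\<lambda>\<omega>. cnj (W \<omega>)) \<in> borel_measurable M"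
    by (rule borel_measurable_continuous_on[OF _ Wm]) (intro continuous_intros)
  have int2: "integrable M (\<lambda>\<omega>. cnj (W \<omega>) * iexp (t * Y \<omega>))" for t
    using W by (rule Bochner_Integration.integrable_bound) (auto simp: norm_mult)
  have cut: "integrable M (\<lambda>\<omega>. W \<omega> * indicator B (Y \<omega>))"
    using W by (rule Bochner_Integration.integrable_bound) (auto simp: indicator_def)
  have conj: "(\<integral>\<omega>. cnj (W \<omega>) * iexp (t * Y \<omega>) \<partial>M) = 0" for t
  proof -
    have "(\<integral>\<omega>. cnj (W \<omega>) * iexp (t * Y \<omega>) \<partial>M) = (\<integral>\<omega>. cnj (W \<omega> * iexp ((- t) * Y \<omega>)) \<partial>M)"
      by (intro Bochner_Integration.integral_cong) (auto simp: exp_cnj)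
    also have "\<dots> = cnj (\<integral>\<omega>. W \<omega> * iexp ((- t) * Y \<omega>) \<partial>M)"
      by (rule Bochner_Integration.integral_cnj)
    finally show ?thesis using fourier[of "- t"] by simp
  qed
  have "(\<integral>\<omega>. Re (W \<omega>) *\<^sub>R iexp (t * Y \<omega>) \<partial>M)
      = (\<integral>\<omega>. (W \<omega> * iexp (t * Y \<omega>) + cnj (W \<omega>) * iexp (t * Y \<omega>)) / 2 \<partial>M)" for t
    by (intro Bochner_Integration.integral_cong)
      (auto simp: scaleR_conv_of_real complex_add_cnj distrib_right[symmetric])
  then have re: "(\<integral>\<omega>. Re (W \<omega>) *\<^sub>R iexp (t * Y \<omega>) \<partial>M) = 0" for t
    by (simp only: Bochner_Integration.integral_divide_zero
        Bochner_Integration.integral_add[OF int1 int2] fourier conj) simp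
  have i_mult_i: "\<i> * (\<i> * z) = - z" for z by (simp add: mult.assoc[symmetric])
  have "(\<integral>\<omega>. Im (W \<omega>) *\<^sub>R iexp (t * Y \<omega>) \<partial>M)
      = (\<integral>\<omega>. (W \<omega> * iexp (t * Y \<omega>) - cnj (W \<omega>) * iexp (t * Y \<omega>)) / (2 * \<i>) \<partial>M)" for t
    by (intro Bochner_Integration.integral_cong)
      (auto simp: scaleR_conv_of_real complex_diff_cnj left_diff_distrib[symmetric] i_mult_i mult_ac)
  then have im: "(\<integral>\<omega>. Im (W \<omega>) *\<^sub>R iexp (t * Y \<omega>) \<partial>M) = 0" for t
    by (simp only: Bochner_Integration.integral_divide_zero
        Bochner_Integration.integral_diff[OF int1 int2] fourier conj) simp
  have "Re (\<integral>\<omega>. W \<omega> * indicator B (Y \<omega>) \<partial>M) = (\<integral>\<omega>. Re (W \<omega>) * indicator B (Y \<omega>) \<partial>M)"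
    using cut by (subst integral_Re[symmetric]) (auto intro!: Bochner_Integration.integral_cong simp: indicator_def)
  moreover have "Im (\<integral>\<omega>. W \<omega> * indicator B (Y \<omega>) \<partial>M) = (\<integral>\<omega>. Im (W \<omega>) * indicator B (Y \<omega>) \<partial>M)"
    using cut by (subst integral_Im[symmetric]) (auto intro!: Bochner_Integration.integral_cong simp: indicator_def)
  moreover have "(\<integral>\<omega>. Re (W \<omega>) * indicator B (Y \<omega>) \<partial>M) = 0"
    by (rule integral_indicator_zero_if_fourier_zero_real[OF _ Y re B]) (use W in simp)
  moreover have "(\<integral>\<omega>. Im (W \<omega>) * indicator B (Y \<omega>) \<partial>M) = 0"
    by (rule integral_indicator_zero_if_fourier_zero_real[OF _ Y im B]) (use W in simp)
  ultimately show ?thesis by (simp add: complex_eq_iff)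
qed

text \<open>In the induction step, the exponential in the new coordinate is absorbed into the weight, so that
  the indicators of the old coordinates can be introduced first; then the one-dimensional result is
  applied to the new coordinate with these indicators as part of the weight.\<close>

lemma integral_prod_indicator_zero_if_fourier_zero:
  fixes W :: "'w \<Rightarrow> complex" and Y :: "'i \<Rightarrow> 'w \<Rightarrow> real"
  assumes "finite I" and "integrable M W" and Y[measurable]: "\<And>i. Y i \<in> borel_measurable M"
    and "\<And>t. (\<integral>\<omega>. W \<omega> * iexp (\<Sum>i\<in>I. t i * Y i \<omega>) \<partial>M) = 0"
    and B[measurable]: "\<And>i. B i \<in> sets borel"
  shows "(\<integral>\<omega>. W \<omega> * (\<Prod>i\<in>I. indicator (B i) (Y i \<omega>)) \<partial>M) = 0"
  using assms(1,2,4)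
proof (induction I arbitrary: W rule: finite_induct)
  case empty
  then show ?case by simp
next
  case (insert k I)
  have [measurable]: "W \<in> borel_measurable M" using insert.prems(1) by simp
  let ?cut = "\<lambda>\<omega>. \<Prod>i\<in>I. indicator (B i) (Y i \<omega>) :: complex"
  have cut_le: "norm (?cut \<omega>) \<le> 1" for \<omega>
    unfolding prod_norm[symmetric] by (intro prod_le_1) (auto simp: indicator_def)
  have "(\<integral>\<omega>. (W \<omega> * ?cut \<omega>) * indicator (B k) (Y k \<omega>) \<partial>M) = 0"
  proof (rule integral_indicator_zero_if_fourier_zero[OF _ Y _ B])
    show "integrable M (\<lambda>\<omega>. W \<omega> * ?cut \<omega>)"
      using insert.prems(1) by (rule Bochner_Integration.integrable_bound)
        (auto simp: norm_mult intro!: mult_left_le cut_le)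
    fix r
    have "(\<integral>\<omega>. (W \<omega> * iexp (r * Y k \<omega>)) * ?cut \<omega> \<partial>M) = 0"
    proof (rule insert.IH)
      show "integrable M (\<lambda>\<omega>. W \<omega> * iexp (r * Y k \<omega>))"
        using insert.prems(1) by (rule Bochner_Integration.integrable_bound) (auto simp: norm_mult)
      fix t
      have "(\<Sum>i\<in>I. (t(k := r)) i * Y i \<omega>) = (\<Sum>i\<in>I. t i * Y i \<omega>)" for \<omega>
        using insert.hyps by (intro sum.cong) auto
      then show "(\<integral>\<omega>. W \<omega> * iexp (r * Y k \<omega>) * iexp (\<Sum>i\<in>I. t i * Y i \<omega>) \<partial>M) = 0"
        using insert.prems(2)[of "t(k := r)"] insert.hyps
        by (simp add: exp_add distrib_left mult.assoc)
    qed
    then show "(\<integral>\<omega>. (W \<omega> * ?cut \<omega>) * iexp (r * Y k \<omega>) \<partial>M) = 0"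
      by (simp add: mult_ac)
  qed
  then show ?case using insert.hyps by (simp add: mult_ac)
qed

lemma measurable_vec_lambda:
  fixes Y :: "'m::finite \<Rightarrow> 'w \<Rightarrow> real"
  assumes "\<And>m. Y m \<in> borel_measurable M"
  shows "(\<lambda>\<omega>. \<chi> m. Y m \<omega>) \<in> borel_measurable M"
proof (rule borel_measurable_euclidean_space[THEN iffD2], intro ballI)
  fix b :: "real ^ 'm" assume "b \<in> Basis"
  then obtain i where "b = axis i 1" by (auto simp: Basis_vec_def)
  then show "(\<lambda>\<omega>. (\<chi> m. Y m \<omega>) \<bullet> b) \<in> borel_measurable M"
    using assms[of i] by (simp add: inner_axis)
qed

text \<open>The previous lemma settles the lower orthants \<open>{..a}\<close>, which form a generator of the Borel sets
  that is stable under intersection.\<close>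

lemma integral_vector_indicator_zero_if_fourier_zero:
  fixes Z :: "'w \<Rightarrow> real" and Y :: "'m::finite \<Rightarrow> 'w \<Rightarrow> real"
  assumes Z: "integrable M Z" and Y[measurable]: "\<And>m. Y m \<in> borel_measurable M"
    and fourier: "\<And>t. (\<integral>\<omega>. complex_of_real (Z \<omega>) * iexp (\<Sum>m\<in>UNIV. t m * Y m \<omega>) \<partial>M) = 0"
    and B: "B \<in> sets borel"
  shows "(\<integral>\<omega>. Z \<omega> * indicator B (\<chi> m. Y m \<omega>) \<partial>M) = 0"
proof -
  define V where "V = (\<lambda>\<omega>. \<chi> m. Y m \<omega>)"
  have V[measurable]: "V \<in> borel_measurable M" unfolding V_def by (rule measurable_vec_lambda) simp
  have Zm[measurable]: "Z \<in> borel_measurable M" using Z by simp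
  have cut: "integrable M (\<lambda>\<omega>. Z \<omega> * indicator S (V \<omega>))" if [measurable]: "S \<in> sets borel" for S
    using Z by (rule Bochner_Integration.integrable_bound) (auto simp: indicator_def)
  have sets: "sets (borel :: (real ^ 'm) measure) = sigma_sets UNIV (range (\<lambda>a. {..a}))"
    by (subst borel_eq_atMost) simp
  have stable: "Int_stable (range (\<lambda>a :: real ^ 'm. {..a}))"
  proof (rule Int_stableI_image)
    fix a b :: "real ^ 'm"
    have "{..a} \<inter> {..b} = {..inf a b}" by auto
    then show "\<exists>c\<in>UNIV. {..a} \<inter> {..b} = {..c}" by blast
  qed
  have rects: "range (\<lambda>a :: real ^ 'm. {..a}) \<subseteq> Pow UNIV" by simp
  have "(\<integral>\<omega>. Z \<omega> * indicator B (V \<omega>) \<partial>M) = 0"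
    using stable rects B[unfolded sets]
  proof (induction B rule: sigma_sets_induct_disjoint)
    case (basic A)
    then obtain a where A: "A = {..a}" by auto
    have "indicator A (V \<omega>) = (\<Prod>m\<in>UNIV. indicator {..a $ m} (Y m \<omega>) :: real)" for \<omega>
    proof (cases "\<forall>m. Y m \<omega> \<le> a $ m")
      case True
      then show ?thesis by (simp add: A V_def less_eq_vec_def)
    next
      case False
      then obtain k where "\<not> Y k \<omega> \<le> a $ k" by blast
      then have "(\<Prod>m\<in>UNIV. indicator {..a $ m} (Y m \<omega>)) = (0::real)"
        by (intro prod_zero bexI[of _ k]) auto
      with False show ?thesis by (auto simp: A V_def less_eq_vec_def)
    qed
    then have "complex_of_real (\<integral>\<omega>. Z \<omega> * indicator A (V \<omega>) \<partial>M)
        = (\<integral>\<omega>. complex_of_real (Z \<omega>) * (\<Prod>m\<in>UNIV. indicator {..a $ m} (Y m \<omega>)) \<partial>M)"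
      by (subst integral_complex_of_real[symmetric])
        (auto intro!: Bochner_Integration.integral_cong prod.cong simp: indicator_def)
    also have "\<dots> = 0"
      by (rule integral_prod_indicator_zero_if_fourier_zero[OF _ _ Y fourier]) (use Z in auto)
    finally show ?case by simp
  next
    case empty
    then show ?case by simp
  next
    case (compl A)
    then have [measurable]: "A \<in> sets borel" by (simp add: sets)
    have "complex_of_real (\<integral>\<omega>. Z \<omega> \<partial>M) = 0"
      using fourier[of "\<lambda>_. 0"] by simp
    moreover have "Z \<omega> * indicator (UNIV - A) (V \<omega>) = Z \<omega> - Z \<omega> * indicator A (V \<omega>)" for \<omega>
      by (auto simp: indicator_def)
    ultimately show ?case using compl cut[of A] Z by simp
  next
    case (union A)
    then have A[measurable]: "A i \<in> sets borel" for i by (auto simp: sets)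
    have eq: "(\<integral>\<omega>. Z \<omega> * indicator S (V \<omega>) \<partial>M) = (\<integral>\<omega>\<in>V -` S \<inter> space M. Z \<omega> \<partial>M)" for S
      unfolding set_lebesgue_integral_def
      by (intro Bochner_Integration.integral_cong) (auto simp: indicator_def)
    have "(\<integral>\<omega>\<in>(\<Union>i. V -` A i \<inter> space M). Z \<omega> \<partial>M) = (\<Sum>i. \<integral>\<omega>\<in>V -` A i \<inter> space M. Z \<omega> \<partial>M)"
    proof (rule lebesgue_integral_countable_add)
      show "(V -` A i \<inter> space M) \<inter> (V -` A j \<inter> space M) = {}" if "i \<noteq> j" for i j
        using union(1) that by (auto simp: disjoint_family_on_def)
      show "set_integrable M (\<Union>i. V -` A i \<inter> space M) Z"
        unfolding set_integrable_def using Z by (intro integrable_mult_indicator) auto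
    qed auto
    also have "\<dots> = 0" using union(3) by (simp add: eq)
    finally show ?case by (simp add: eq vimage_Union)
  qed
  then show ?thesis by (simp add: V_def)
qed

section \<open>Conditional means from symmetry\<close>

context prob_space
begin

text \<open>The symmetry says that the integral of \<open>sin (s Z) e\<^sup>i\<^sup>U\<close> vanishes for all \<open>s\<close>. Divide by \<open>s = 1 / Suc n\<close>
  and let \<open>s\<close> tend to \<open>0\<close>; the quotients are dominated by \<open>\<bar>Z\<bar>\<close>.\<close>

lemma integral_fourier_zero_if_reflection_symmetric:
  fixes Z U :: "'a \<Rightarrow> real"
  assumes Z: "integrable M Z" and U[measurable]: "U \<in> borel_measurable M"
    and sym: "\<And>s. (\<integral>\<omega>. iexp (s * Z \<omega> + U \<omega>) \<partial>M) = (\<integral>\<omega>. iexp (- s * Z \<omega> + U \<omega>) \<partial>M)"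
  shows "(\<integral>\<omega>. complex_of_real (Z \<omega>) * iexp (U \<omega>) \<partial>M) = 0"
proof -
  have [measurable]: "Z \<in> borel_measurable M" using Z by simp
  let ?f = "\<lambda>n \<omega>. complex_of_real (real (Suc n) * sin (Z \<omega> / real (Suc n))) * iexp (U \<omega>)"
  have int: "integrable M (\<lambda>\<omega>. iexp (s * Z \<omega> + U \<omega>))" for s
    by (rule integrable_iexp) auto
  have zero: "(\<integral>\<omega>. ?f n \<omega> \<partial>M) = 0" for n
  proof -
    let ?s = "1 / real (Suc n)"
    have "?f n \<omega> = (complex_of_real (real (Suc n)) / (2 * \<i>)) * (iexp (?s * Z \<omega> + U \<omega>) - iexp (- ?s * Z \<omega> + U \<omega>))" for \<omega>
    proof -
      have "iexp (?s * Z \<omega> + U \<omega>) - iexp (- ?s * Z \<omega> + U \<omega>)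
          = (iexp (?s * Z \<omega>) - iexp (- (?s * Z \<omega>))) * iexp (U \<omega>)"
        by (simp add: distrib_left right_diff_distrib exp_add[symmetric] left_diff_distrib)
      also have "iexp (?s * Z \<omega>) - iexp (- (?s * Z \<omega>)) = 2 * \<i> * complex_of_real (sin (?s * Z \<omega>))"
        by (simp add: sin_of_real[symmetric] sin_exp_eq del: of_real_mult)
      finally have diff: "iexp (?s * Z \<omega> + U \<omega>) - iexp (- ?s * Z \<omega> + U \<omega>)
          = 2 * \<i> * complex_of_real (sin (?s * Z \<omega>)) * iexp (U \<omega>)" .
      have cancel: "c / k * (k * x * e) = c * x * e" if "k \<noteq> 0" for c k x e :: complex
        using that by simp
      show ?thesis unfolding diff of_real_mult
        by (subst cancel) simp_all
    qed
    then have "(\<integral>\<omega>. ?f n \<omega> \<partial>M) = (complex_of_real (real (Suc n)) / (2 * \<i>)) *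
        ((\<integral>\<omega>. iexp (?s * Z \<omega> + U \<omega>) \<partial>M) - (\<integral>\<omega>. iexp (- ?s * Z \<omega> + U \<omega>) \<partial>M))"
      using int[of ?s] int[of "- ?s"] by (simp only: integral_mult_right_zero Bochner_Integration.integral_diff)
    then show ?thesis using sym[of ?s] by simp
  qed
  have lim: "(\<lambda>n. real (Suc n) * sin (z / real (Suc n))) \<longlonglongrightarrow> z" for z :: real
    by real_asymp
  have "(\<lambda>n. \<integral>\<omega>. ?f n \<omega> \<partial>M) \<longlonglongrightarrow> (\<integral>\<omega>. complex_of_real (Z \<omega>) * iexp (U \<omega>) \<partial>M)"
  proof (rule integral_dominated_convergence[where w = "\<lambda>\<omega>. \<bar>Z \<omega>\<bar>"])
    show "AE \<omega> in M. (\<lambda>n. ?f n \<omega>) \<longlonglongrightarrow> complex_of_real (Z \<omega>) * iexp (U \<omega>)"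
      by (intro AE_I2 tendsto_mult tendsto_of_real lim tendsto_const)
    have "\<bar>real (Suc n) * sin (z / real (Suc n))\<bar> \<le> \<bar>z\<bar>" for n z
      using mult_left_mono[OF abs_sin_x_le_abs_x[of "z / real (Suc n)"], of "real (Suc n)"]
      by (simp add: abs_mult)
    then show "AE \<omega> in M. norm (?f n \<omega>) \<le> \<bar>Z \<omega>\<bar>" for n
      by (intro AE_I2) (simp only: norm_mult norm_of_real norm_exp_i_times, simp)
  qed (use Z in auto)
  then show ?thesis using zero by (simp add: LIMSEQ_const_iff)
qed

text \<open>For jointly Gaussian variables the hypothesis says exactly that \<open>Z\<close> is centred and uncorrelated
  with \<open>Y\<close>; this form also covers degenerate distributions.\<close>

lemma cond_exp_zero_if_reflection_symmetric:
  fixes Z :: "'a \<Rightarrow> real" and Y :: "'m::finite \<Rightarrow> 'a \<Rightarrow> real"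
  assumes Z: "integrable M Z" and Y[measurable]: "\<And>m. Y m \<in> borel_measurable M"
    and sym: "\<And>s t. (\<integral>\<omega>. iexp (s * Z \<omega> + (\<Sum>m\<in>UNIV. t m * Y m \<omega>)) \<partial>M)
        = (\<integral>\<omega>. iexp (- s * Z \<omega> + (\<Sum>m\<in>UNIV. t m * Y m \<omega>)) \<partial>M)"
  shows "AE \<omega> in M. real_cond_exp M (vimage_algebra (space M) (\<lambda>\<omega>. \<chi> m. Y m \<omega>) borel) Z \<omega> = 0"
proof -
  let ?V = "\<lambda>\<omega>. \<chi> m. Y m \<omega>"
  let ?F = "vimage_algebra (space M) ?V borel"
  have V: "?V \<in> borel_measurable M" by (rule measurable_vec_lambda) simp
  interpret finite_measure_subalgebra M ?F
    using V by unfold_locales (auto simp: subalgebra_def sets_vimage_algebra2 measurable_sets)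
  show ?thesis
  proof (rule real_cond_exp_charact)
    fix A assume "A \<in> sets ?F"
    then obtain B where B: "B \<in> sets borel" "A = ?V -` B \<inter> space M"
      by (auto simp: sets_vimage_algebra2)
    have "(\<integral>\<omega>\<in>A. Z \<omega> \<partial>M) = (\<integral>\<omega>. Z \<omega> * indicator B (?V \<omega>) \<partial>M)"
      unfolding set_lebesgue_integral_def B
      by (intro Bochner_Integration.integral_cong) (auto simp: indicator_def)
    also have "\<dots> = 0"
      using Z Y _ B(1)
    proof (rule integral_vector_indicator_zero_if_fourier_zero)
      show "(\<integral>\<omega>. complex_of_real (Z \<omega>) * iexp (\<Sum>m\<in>UNIV. t m * Y m \<omega>) \<partial>M) = 0" for t
        using Z sym by (intro integral_fourier_zero_if_reflection_symmetric) auto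
    qed
    finally show "(\<integral>\<omega>\<in>A. Z \<omega> \<partial>M) = (\<integral>\<omega>\<in>A. 0 \<partial>M)"
      by (simp add: set_lebesgue_integral_def)
  qed (use Z in auto)
qed

text \<open>The second claim is the Pythagorean theorem in \<open>L\<^sub>2\<close>: a competitor differs from \<open>h (Y)\<close> by a function
  of \<open>Y\<close>, to which the residual is orthogonal. A competitor with infinite error is trivially
  worse; for the others that function is square integrable.\<close>

lemma conditional_mean_and_mmse_if_residual:
  fixes X :: "'a \<Rightarrow> real" and Y :: "'a \<Rightarrow> real ^ 'm"
  assumes X[measurable]: "X \<in> borel_measurable M" and Y[measurable]: "Y \<in> borel_measurable M"
    and h[measurable]: "h \<in> borel_measurable borel"
    and X1: "integrable M X"
    and Z2: "integrable M (\<lambda>\<omega>. (X \<omega> - h (Y \<omega>))\<^sup>2)"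
    and Z0: "AE \<omega> in M. real_cond_exp M (vimage_algebra (space M) Y borel) (\<lambda>\<omega>. X \<omega> - h (Y \<omega>)) \<omega> = 0"
  shows "is_conditional_mean M Y X h" and "is_mmse_estimator M Y X h"
proof -
  let ?F = "vimage_algebra (space M) Y borel"
  let ?Z = "\<lambda>\<omega>. X \<omega> - h (Y \<omega>)"
  interpret finite_measure_subalgebra M ?F
    using Y by unfold_locales (auto simp: subalgebra_def sets_vimage_algebra2 measurable_sets)
  have YF[measurable]: "Y \<in> ?F \<rightarrow>\<^sub>M borel"
    by (rule measurable_vimage_algebra1) simp
  have Z1: "integrable M ?Z"
    by (rule square_integrable_imp_integrable[OF _ Z2]) simp
  have hY: "integrable M (\<lambda>\<omega>. h (Y \<omega>))"
    using Bochner_Integration.integrable_diff[OF X1 Z1] by simp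
  have "AE \<omega> in M. real_cond_exp M ?F (\<lambda>\<omega>. ?Z \<omega> + h (Y \<omega>)) \<omega> = real_cond_exp M ?F ?Z \<omega> + real_cond_exp M ?F (\<lambda>\<omega>. h (Y \<omega>)) \<omega>"
    by (rule real_cond_exp_add[OF Z1 hY])
  moreover have "AE \<omega> in M. real_cond_exp M ?F (\<lambda>\<omega>. h (Y \<omega>)) \<omega> = h (Y \<omega>)"
    by (rule real_cond_exp_F_meas[OF hY]) simp
  ultimately have "AE \<omega> in M. real_cond_exp M ?F X \<omega> = h (Y \<omega>)"
    using Z0 by eventually_elim simp
  then show "is_conditional_mean M Y X h"
    using X1 h by (simp add: is_conditional_mean_def)
  have "(\<integral>\<^sup>+ \<omega>. ennreal ((?Z \<omega>)\<^sup>2) \<partial>M) \<le> (\<integral>\<^sup>+ \<omega>. ennreal ((X \<omega> - h' (Y \<omega>))\<^sup>2) \<partial>M)"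
    if [measurable]: "h' \<in> borel_measurable borel" for h'
  proof (cases "integrable M (\<lambda>\<omega>. (X \<omega> - h' (Y \<omega>))\<^sup>2)")
    case False
    then have "(\<integral>\<^sup>+ \<omega>. ennreal ((X \<omega> - h' (Y \<omega>))\<^sup>2) \<partial>M) = \<infinity>"
      by (simp add: integrable_iff_bounded less_top[symmetric])
    then show ?thesis by simp
  next
    case True
    define d where "d = (\<lambda>\<omega>. h' (Y \<omega>) - h (Y \<omega>))"
    have d[measurable]: "d \<in> borel_measurable ?F" unfolding d_def by measurable
    have dM[measurable]: "d \<in> borel_measurable M" unfolding d_def by measurable
    have d2: "integrable M (\<lambda>\<omega>. (d \<omega>)\<^sup>2)"
    proof (rule Bochner_Integration.integrable_bound[where f = "\<lambda>\<omega>. 2 * (?Z \<omega>)\<^sup>2 + 2 * (X \<omega> - h' (Y \<omega>))\<^sup>2"])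
      have "(b - c)\<^sup>2 \<le> 2 * (x - c)\<^sup>2 + 2 * (x - b)\<^sup>2" for x b c :: real
        using zero_le_power2[of "(x - c) + (x - b)"] by (simp add: power2_eq_square algebra_simps)
      then show "AE \<omega> in M. norm ((d \<omega>)\<^sup>2) \<le> norm (2 * (?Z \<omega>)\<^sup>2 + 2 * (X \<omega> - h' (Y \<omega>))\<^sup>2)"
        by (auto simp: d_def)
    qed (use Z2 True in auto)
    have dZ: "integrable M (\<lambda>\<omega>. d \<omega> * ?Z \<omega>)"
    proof (rule Bochner_Integration.integrable_bound[where f = "\<lambda>\<omega>. (?Z \<omega>)\<^sup>2 + (d \<omega>)\<^sup>2"])
      have "\<bar>x * z\<bar> \<le> z\<^sup>2 + x\<^sup>2" for x z :: real
        using zero_le_power2[of "\<bar>x\<bar> - \<bar>z\<bar>"] mult_nonneg_nonneg[OF abs_ge_zero abs_ge_zero, of x z]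
        unfolding power2_diff abs_mult power2_abs by linarith
      then show "AE \<omega> in M. norm (d \<omega> * ?Z \<omega>) \<le> norm ((?Z \<omega>)\<^sup>2 + (d \<omega>)\<^sup>2)"
        by auto
    qed (use Z2 d2 in auto)
    have "(\<integral>\<omega>. d \<omega> * ?Z \<omega> \<partial>M) = (\<integral>\<omega>. d \<omega> * real_cond_exp M ?F ?Z \<omega> \<partial>M)"
      by (rule real_cond_exp_intg(2)[symmetric, OF dZ d]) simp
    also have "\<dots> = 0" using Z0 by (intro integral_eq_zero_AE) auto
    finally have orth: "(\<integral>\<omega>. d \<omega> * ?Z \<omega> \<partial>M) = 0" .
    have "(X \<omega> - h' (Y \<omega>))\<^sup>2 = (?Z \<omega>)\<^sup>2 + (d \<omega>)\<^sup>2 - 2 * (d \<omega> * ?Z \<omega>)" for \<omega>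
      by (simp add: d_def power2_eq_square algebra_simps)
    then have "(\<integral>\<omega>. (X \<omega> - h' (Y \<omega>))\<^sup>2 \<partial>M) = (\<integral>\<omega>. (?Z \<omega>)\<^sup>2 \<partial>M) + (\<integral>\<omega>. (d \<omega>)\<^sup>2 \<partial>M)"
      using Z2 d2 dZ orth by simp
    then have "(\<integral>\<omega>. (?Z \<omega>)\<^sup>2 \<partial>M) \<le> (\<integral>\<omega>. (X \<omega> - h' (Y \<omega>))\<^sup>2 \<partial>M)" by simp
    then show ?thesis
      using Z2 True by (simp add: nn_integral_eq_integral)
  qed
  then show "is_mmse_estimator M Y X h"
    using h by (simp add: is_mmse_estimator_def)
qed

end

section \<open>The extended Gaussian process\<close>

lemma (in prob_space) gaussian_rv_square_integrable:
  assumes "gaussian_rv M X 0 v"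
  shows "integrable M (\<lambda>\<omega>. (X \<omega>)\<^sup>2)"
proof -
  have [measurable]: "X \<in> borel_measurable M" using assms by (simp add: gaussian_rv_def)
  consider "AE \<omega> in M. X \<omega> = 0"
    | "v > 0" "distributed M lborel X (\<lambda>t. ennreal (normal_density 0 (sqrt v) t))"
    using assms by (auto simp: gaussian_rv_def)
  then show ?thesis
  proof cases
    case 1
    then have "integrable M (\<lambda>\<omega>. (X \<omega>)\<^sup>2) \<longleftrightarrow> integrable M (\<lambda>\<omega>. 0 :: real)"
      by (intro integrable_cong_AE) auto
    then show ?thesis by simp
  next
    case 2
    have "integrable lborel (\<lambda>x. normal_density 0 (sqrt v) x * (x - 0)\<^sup>2)"
      using 2 by (intro integrable_normal_moment) simp
    then show ?thesis
      by (subst distributed_integrable[OF 2(2), symmetric]) auto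
  qed
qed

lemma (in prob_space) gaussian_rv_char:
  assumes "gaussian_rv M X 0 v"
  shows "(\<integral>\<omega>. iexp (X \<omega>) \<partial>M) = complex_of_real (exp (- v / 2))"
proof -
  have [measurable]: "X \<in> borel_measurable M" using assms by (simp add: gaussian_rv_def)
  consider "v = 0" "AE \<omega> in M. X \<omega> = 0"
    | "v > 0" "distributed M lborel X (\<lambda>t. ennreal (normal_density 0 (sqrt v) t))"
    using assms by (auto simp: gaussian_rv_def)
  then show ?thesis
  proof cases
    case 1
    have "(\<integral>\<omega>. iexp (X \<omega>) \<partial>M) = (\<integral>\<omega>. 1 \<partial>M)"
      by (rule integral_cong_AE) (use 1 in auto)
    then show ?thesis using 1 by (simp add: prob_space)
  next
    case 2
    have std: "distributed M lborel (\<lambda>\<omega>. (X \<omega> - 0) / sqrt v) std_normal_density"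
      using 2 by (subst normal_standard_normal_convert[symmetric]) auto
    have "(\<integral>\<omega>. iexp (X \<omega>) \<partial>M) = (\<integral>\<omega>. iexp (sqrt v * ((X \<omega> - 0) / sqrt v)) \<partial>M)"
      using 2 by (intro Bochner_Integration.integral_cong) auto
    also have "\<dots> = (\<integral>x. iexp (sqrt v * x) \<partial>distr M lborel (\<lambda>\<omega>. (X \<omega> - 0) / sqrt v))"
      by (subst integral_distr) auto
    also have "\<dots> = char std_normal_distribution (sqrt v)"
      unfolding distributed_distr_eq_density[OF std] by (simp add: char_def)
    also have "\<dots> = complex_of_real (exp (- v / 2))"
      using 2 by (simp add: char_std_normal_distribution)
    finally show ?thesis .
  qed
qed

text \<open>The function \<open>e\<^sup>i\<^sup>x\<close> is Lipschitz with constant \<open>1\<close>, and the squared mean of \<open>\<bar>X - X'\<bar>\<close> is at most its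
  mean square. Characteristic functions therefore pass to mean-square limits.\<close>

lemma (in prob_space) norm_char_diff_le:
  fixes X X' :: "'a \<Rightarrow> real"
  assumes [measurable]: "X \<in> borel_measurable M" "X' \<in> borel_measurable M"
    and D2: "integrable M (\<lambda>\<omega>. (X \<omega> - X' \<omega>)\<^sup>2)"
  shows "(norm ((\<integral>\<omega>. iexp (X \<omega>) \<partial>M) - (\<integral>\<omega>. iexp (X' \<omega>) \<partial>M)))\<^sup>2 \<le> (\<integral>\<omega>. (X \<omega> - X' \<omega>)\<^sup>2 \<partial>M)"
proof -
  let ?D = "\<lambda>\<omega>. \<bar>X \<omega> - X' \<omega>\<bar>"
  have D1: "integrable M ?D"
    using square_integrable_imp_integrable[OF _ D2] by simp
  have lip: "norm (iexp x - iexp y) \<le> \<bar>x - y\<bar>" for x y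
  proof -
    have "iexp x - iexp y = iexp y * (iexp (x - y) - 1)"
      by (simp add: right_diff_distrib exp_add[symmetric])
    then show ?thesis using iexp_approx1[of "x - y" 0] by (simp add: norm_mult)
  qed
  have "(\<integral>\<omega>. iexp (X \<omega>) \<partial>M) - (\<integral>\<omega>. iexp (X' \<omega>) \<partial>M) = (\<integral>\<omega>. iexp (X \<omega>) - iexp (X' \<omega>) \<partial>M)"
    by (intro Bochner_Integration.integral_diff[symmetric] integrable_iexp) auto
  then have "norm ((\<integral>\<omega>. iexp (X \<omega>) \<partial>M) - (\<integral>\<omega>. iexp (X' \<omega>) \<partial>M)) \<le> (\<integral>\<omega>. ?D \<omega> \<partial>M)"
    by (simp only:) (rule order_trans[OF integral_norm_bound integral_mono],
      simp_all add: D1 lip integrable_iexp)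
  then have "(norm ((\<integral>\<omega>. iexp (X \<omega>) \<partial>M) - (\<integral>\<omega>. iexp (X' \<omega>) \<partial>M)))\<^sup>2 \<le> (\<integral>\<omega>. ?D \<omega> \<partial>M)\<^sup>2"
    by (rule power_mono) simp
  also have "\<dots> \<le> (\<integral>\<omega>. (?D \<omega>)\<^sup>2 \<partial>M)"
    using variance_positive[of ?D] variance_eq[OF D1] D2 by simp
  finally show ?thesis by simp
qed

locale native_gaussian_process =
  native_space pair \<iota> j N0 p L D Lx A \<kappa> \<phi> a + prob_space M
  for pair :: "'d::locally_convex_space \<Rightarrow> 's::locally_convex_space \<Rightarrow> real"
    and \<iota> :: "'s \<Rightarrow> 'd" and j :: "'s \<Rightarrow> 'l::{real_inner,complete_space}"
    and N0 p L D Lx A and \<kappa> :: "'s \<Rightarrow> 'h::{real_inner,complete_space}" and \<phi> a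
    and M :: "'w measure" +
  fixes G :: "'w \<Rightarrow> 'd" and Gx :: "'h \<Rightarrow> 'w \<Rightarrow> real"
  assumes process: "centered_gaussian_process M (\<lambda>x \<omega>. pair (G \<omega>) x)
           (\<lambda>x y. A_phi pair \<kappa> N0 p \<phi> a (\<kappa> x) (\<kappa> y))"
    and extension: "extends_by_density M pair \<kappa> G Gx"
begin

lemma pair_G: "gaussian_rv M (\<lambda>\<omega>. pair (G \<omega>) x) 0 ((norm (proj_A (\<kappa> x)))\<^sup>2)"
  using process[unfolded centered_gaussian_process_def, rule_format, where N = 1 and x = "\<lambda>_. x" and t = "\<lambda>_. 1"]
  by (simp add: A_phi_eq_inner power2_norm_eq_inner)

lemma measurable_pair_G [measurable]: "(\<lambda>\<omega>. pair (G \<omega>) x) \<in> borel_measurable M"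
  using pair_G by (simp add: gaussian_rv_def)

lemma measurable_Gx [measurable]: "Gx u \<in> borel_measurable M"
  using extension by (simp add: extends_by_density_def)

lemma Gx_limit:
  assumes "(\<lambda>k. \<kappa> (x k)) \<longlonglongrightarrow> u"
  shows "(\<lambda>k. \<integral>\<^sup>+ \<omega>. ennreal ((pair (G \<omega>) (x k) - Gx u \<omega>)\<^sup>2) \<partial>M) \<longlonglongrightarrow> 0"
  using extension assms by (simp add: extends_by_density_def)

lemma approximating_sequence:
  obtains x where "(\<lambda>k. \<kappa> (x k)) \<longlonglongrightarrow> u"
proof -
  have "u \<in> closure (range \<kappa>)" by (simp add: \<kappa>_completion)
  then obtain v where v: "\<forall>n. v n \<in> range \<kappa>" "v \<longlonglongrightarrow> u" by (auto simp: closure_sequential)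
  then have "\<kappa> (inv \<kappa> (v n)) = v n" for n by (simp add: f_inv_into_f)
  with v(2) show thesis by (intro that[of "\<lambda>n. inv \<kappa> (v n)"]) simp
qed

text \<open>Both facts hold on test functions and survive the mean-square limit, the variance because the
  projection is continuous.\<close>

lemma Gx_square_integrable: "integrable M (\<lambda>\<omega>. (Gx u \<omega>)\<^sup>2)"
  and Gx_char: "(\<integral>\<omega>. iexp (Gx u \<omega>) \<partial>M) = complex_of_real (exp (- (norm (proj_A u))\<^sup>2 / 2))"
proof -
  obtain x where x: "(\<lambda>k. \<kappa> (x k)) \<longlonglongrightarrow> u" by (rule approximating_sequence)
  define D where "D k \<omega> = pair (G \<omega>) (x k) - Gx u \<omega>" for k \<omega>
  have [measurable]: "D k \<in> borel_measurable M" for k unfolding D_def by measurable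
  have lim: "(\<lambda>k. \<integral>\<^sup>+ \<omega>. ennreal ((D k \<omega>)\<^sup>2) \<partial>M) \<longlonglongrightarrow> 0"
    using Gx_limit[OF x] by (simp add: D_def)
  then have "eventually (\<lambda>k. (\<integral>\<^sup>+ \<omega>. ennreal ((D k \<omega>)\<^sup>2) \<partial>M) < 1) sequentially"
    by (rule order_tendstoD) simp
  then have fin: "eventually (\<lambda>k. integrable M (\<lambda>\<omega>. (D k \<omega>)\<^sup>2)) sequentially"
    by eventually_elim (auto simp: integrable_iff_bounded intro: less_trans)
  then obtain k where k: "integrable M (\<lambda>\<omega>. (D k \<omega>)\<^sup>2)"
    by (auto simp: eventually_sequentially)
  show "integrable M (\<lambda>\<omega>. (Gx u \<omega>)\<^sup>2)"
  proof (rule Bochner_Integration.integrable_bound)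
    show "integrable M (\<lambda>\<omega>. 2 * (pair (G \<omega>) (x k))\<^sup>2 + 2 * (D k \<omega>)\<^sup>2)"
      using k gaussian_rv_square_integrable[OF pair_G] by simp
    have "b\<^sup>2 \<le> 2 * c\<^sup>2 + 2 * (c - b)\<^sup>2" for b c :: real
      using zero_le_power2[of "2 * c - b"] by (simp add: power2_eq_square algebra_simps)
    then show "AE \<omega> in M. norm ((Gx u \<omega>)\<^sup>2) \<le> norm (2 * (pair (G \<omega>) (x k))\<^sup>2 + 2 * (D k \<omega>)\<^sup>2)"
      by (simp add: D_def)
  qed simp
  let ?c = "\<lambda>k. \<integral>\<omega>. iexp (pair (G \<omega>) (x k)) \<partial>M" and ?l = "\<integral>\<omega>. iexp (Gx u \<omega>) \<partial>M"
  have "(\<lambda>k. ennreal ((norm (?c k - ?l))\<^sup>2)) \<longlonglongrightarrow> 0"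
  proof (rule tendsto_sandwich[OF _ _ tendsto_const lim])
    show "\<forall>\<^sub>F k in sequentially. ennreal ((norm (?c k - ?l))\<^sup>2) \<le> (\<integral>\<^sup>+ \<omega>. ennreal ((D k \<omega>)\<^sup>2) \<partial>M)"
      using fin
    proof eventually_elim
      case (elim k)
      have "(norm (?c k - ?l))\<^sup>2 \<le> (\<integral>\<omega>. (D k \<omega>)\<^sup>2 \<partial>M)"
        using elim unfolding D_def by (intro norm_char_diff_le) auto
      then show ?case
        using elim by (subst nn_integral_eq_integral) (auto intro: ennreal_leI)
    qed
  qed simp
  then have "(\<lambda>k. (norm (?c k - ?l))\<^sup>2) \<longlonglongrightarrow> 0"
    by (subst (asm) ennreal_0[symmetric], subst (asm) tendsto_ennreal_iff) auto
  then have "(\<lambda>k. sqrt ((norm (?c k - ?l))\<^sup>2)) \<longlonglongrightarrow> sqrt 0" by (rule tendsto_real_sqrt)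
  then have "(\<lambda>k. ?c k - ?l) \<longlonglongrightarrow> 0" by (simp add: tendsto_norm_zero_iff)
  then have "?c \<longlonglongrightarrow> ?l" by (simp add: LIM_zero_iff)
  moreover have "?c \<longlonglongrightarrow> complex_of_real (exp (- (norm (proj_A u))\<^sup>2 / 2))"
  proof -
    have "(\<lambda>k. proj_A (\<kappa> (x k))) \<longlonglongrightarrow> proj_A u"
      by (rule bounded_linear.tendsto[OF bounded_linear_proj_A x])
    then show ?thesis
      unfolding gaussian_rv_char[OF pair_G] by (intro tendsto_intros) auto
  qed
  ultimately show "?l = complex_of_real (exp (- (norm (proj_A u))\<^sup>2 / 2))"
    by (rule LIMSEQ_unique)
qed

text \<open>The extended process is linear only almost surely: as the process itself is linear on test
  functions, the defect is a combination of three approximation errors, each of which tends to zero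
  in mean square.\<close>

lemma Gx_add_scaled: "AE \<omega> in M. Gx (u + c *\<^sub>R v) \<omega> = Gx u \<omega> + c * Gx v \<omega>"
proof -
  obtain x where x: "(\<lambda>k. \<kappa> (x k)) \<longlonglongrightarrow> u" by (rule approximating_sequence)
  obtain y where y: "(\<lambda>k. \<kappa> (y k)) \<longlonglongrightarrow> v" by (rule approximating_sequence)
  have "(\<lambda>k. \<kappa> (x k) + c *\<^sub>R \<kappa> (y k)) \<longlonglongrightarrow> u + c *\<^sub>R v"
    by (intro tendsto_intros x y)
  then have z: "(\<lambda>k. \<kappa> (x k + c *\<^sub>R y k)) \<longlonglongrightarrow> u + c *\<^sub>R v"
    by (simp add: linear_add[OF \<kappa>_completion(1)] linear_scale[OF \<kappa>_completion(1)])
  define F where "F \<omega> = Gx (u + c *\<^sub>R v) \<omega> - (Gx u \<omega> + c * Gx v \<omega>)" for \<omega>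
  have [measurable]: "F \<in> borel_measurable M" unfolding F_def by measurable
  let ?d = "\<lambda>s w \<omega>. (pair (G \<omega>) s - Gx w \<omega>)\<^sup>2"
  let ?I = "\<lambda>s w. \<integral>\<^sup>+ \<omega>. ennreal (?d s w \<omega>) \<partial>M"
  have "(\<integral>\<^sup>+ \<omega>. ennreal ((F \<omega>)\<^sup>2) \<partial>M)
      \<le> ennreal 3 * ?I (x k + c *\<^sub>R y k) (u + c *\<^sub>R v) + ennreal 3 * ?I (x k) u + ennreal (3 * c\<^sup>2) * ?I (y k) v" for k
  proof -
    have three: "(e + f + g)\<^sup>2 \<le> 3 * e\<^sup>2 + 3 * f\<^sup>2 + 3 * g\<^sup>2" for e f g :: real
      using zero_le_power2[of "e - f"] zero_le_power2[of "f - g"] zero_le_power2[of "e - g"]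
      by (simp add: power2_eq_square algebra_simps)
    have "(F \<omega>)\<^sup>2 \<le> 3 * ?d (x k + c *\<^sub>R y k) (u + c *\<^sub>R v) \<omega> + 3 * ?d (x k) u \<omega> + (3 * c\<^sup>2) * ?d (y k) v \<omega>" for \<omega>
    proof -
      have "F \<omega> = - (pair (G \<omega>) (x k + c *\<^sub>R y k) - Gx (u + c *\<^sub>R v) \<omega>)
          + (pair (G \<omega>) (x k) - Gx u \<omega>) + c * (pair (G \<omega>) (y k) - Gx v \<omega>)"
        by (simp add: F_def linear_add[OF pair_linear_right] linear_scale[OF pair_linear_right] algebra_simps)
      then show ?thesis
        using three[of "- (pair (G \<omega>) (x k + c *\<^sub>R y k) - Gx (u + c *\<^sub>R v) \<omega>)"
            "pair (G \<omega>) (x k) - Gx u \<omega>" "c * (pair (G \<omega>) (y k) - Gx v \<omega>)"]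
        by (simp only: power2_minus power_mult_distrib mult.assoc)
    qed
    then have "(\<integral>\<^sup>+ \<omega>. ennreal ((F \<omega>)\<^sup>2) \<partial>M) \<le> (\<integral>\<^sup>+ \<omega>. ennreal (3 * ?d (x k + c *\<^sub>R y k) (u + c *\<^sub>R v) \<omega>
        + 3 * ?d (x k) u \<omega> + (3 * c\<^sup>2) * ?d (y k) v \<omega>) \<partial>M)"
      by (intro nn_integral_mono ennreal_leI)
    also have "\<dots> = (\<integral>\<^sup>+ \<omega>. ennreal 3 * ennreal (?d (x k + c *\<^sub>R y k) (u + c *\<^sub>R v) \<omega>)
        + ennreal 3 * ennreal (?d (x k) u \<omega>) + ennreal (3 * c\<^sup>2) * ennreal (?d (y k) v \<omega>) \<partial>M)"
      by (intro nn_integral_cong) (simp only: ennreal_plus ennreal_mult zero_le_power2 mult_nonneg_nonneg add_nonneg_nonneg zero_le_numeral)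
    also have "\<dots> = ennreal 3 * ?I (x k + c *\<^sub>R y k) (u + c *\<^sub>R v) + ennreal 3 * ?I (x k) u + ennreal (3 * c\<^sup>2) * ?I (y k) v"
      by (simp add: nn_integral_add nn_integral_cmult)
    finally show ?thesis .
  qed
  moreover have "(\<lambda>k. ennreal 3 * ?I (x k + c *\<^sub>R y k) (u + c *\<^sub>R v) + ennreal 3 * ?I (x k) u + ennreal (3 * c\<^sup>2) * ?I (y k) v)
      \<longlonglongrightarrow> ennreal 3 * 0 + ennreal 3 * 0 + ennreal (3 * c\<^sup>2) * 0"
    by (intro tendsto_add ennreal_tendsto_cmult Gx_limit x y z) auto
  ultimately have "(\<integral>\<^sup>+ \<omega>. ennreal ((F \<omega>)\<^sup>2) \<partial>M) \<le> 0"
    by (intro LIMSEQ_le_const) auto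
  then have "AE \<omega> in M. ennreal ((F \<omega>)\<^sup>2) = 0"
    by (subst nn_integral_0_iff_AE[symmetric]) auto
  then show ?thesis by eventually_elim (simp add: F_def)
qed

lemma Gx_zero: "AE \<omega> in M. Gx 0 \<omega> = 0"
  using Gx_add_scaled[of 0 1 0] by simp

lemma Gx_sum: "finite I \<Longrightarrow> AE \<omega> in M. Gx (\<Sum>i\<in>I. t i *\<^sub>R v i) \<omega> = (\<Sum>i\<in>I. t i * Gx (v i) \<omega>)"
proof (induction I rule: finite_induct)
  case empty
  then show ?case using Gx_zero by simp
next
  case (insert i I)
  show ?case
    using Gx_add_scaled[of "\<Sum>i\<in>I. t i *\<^sub>R v i" "t i" "v i"] insert.IH
    by eventually_elim (use insert.hyps in \<open>simp add: add.commute\<close>)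
qed

text \<open>The residual of \<open>Gx u\<close> is almost surely \<open>Gx w\<close>, where \<open>w\<close> is orthogonal to all observations.
  As the \<open>\<phi> n\<close> are in the span of the observations, \<open>w\<close> is fixed by the projection; hence orthogonality
  in \<open>\<H>'\<close> is uncorrelatedness, and the joint characteristic function of the residual and the
  data is even in the residual.\<close>

lemma regression_on_observations:
  fixes \<nu> :: "'m::finite \<Rightarrow> 'h" and c :: "real ^ 'm"
  assumes \<phi>_span: "span (\<phi> ` {..<N0}) \<subseteq> span (range \<nu>)"
    and orth: "\<And>m. inner (u - (\<Sum>k\<in>UNIV. c $ k *\<^sub>R \<nu> k)) (\<nu> m) = 0"
  shows "is_conditional_mean M (\<lambda>\<omega>. \<chi> m. Gx (\<nu> m) \<omega>) (Gx u) (\<lambda>y. \<Sum>k\<in>UNIV. c $ k * y $ k)"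
    and "is_mmse_estimator M (\<lambda>\<omega>. \<chi> m. Gx (\<nu> m) \<omega>) (Gx u) (\<lambda>y. \<Sum>k\<in>UNIV. c $ k * y $ k)"
proof -
  let ?Y = "\<lambda>\<omega>. \<chi> m. Gx (\<nu> m) \<omega>"
  let ?h = "\<lambda>y :: real ^ 'm. \<Sum>k\<in>UNIV. c $ k * y $ k"
  define w where "w = u - (\<Sum>k\<in>UNIV. c $ k *\<^sub>R \<nu> k)"
  define Z where "Z \<omega> = Gx u \<omega> - (\<Sum>k\<in>UNIV. c $ k * Gx (\<nu> k) \<omega>)" for \<omega>
  have [measurable]: "Z \<in> borel_measurable M" unfolding Z_def by measurable
  have w_orth: "inner w v = 0" if "v \<in> span (range \<nu>)" for v
    using bounded_linear.linear[OF bounded_linear_inner_right] _ that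
  proof (rule linear_eq_0_on_span)
    show "inner w y = 0" if "y \<in> range \<nu>" for y using orth that by (auto simp: w_def)
  qed
  have "\<phi> n \<in> span (range \<nu>)" if "n < N0" for n
    using \<phi>_span span_base[of "\<phi> n" "\<phi> ` {..<N0}"] that by blast
  then have Prw: "proj_A w = w"
    using w_orth by (intro proj_A_eq_self_if_orthogonal) (simp add: inner_commute[of _ w])
  have Z_eq: "AE \<omega> in M. Gx w \<omega> = Z \<omega>"
    using Gx_add_scaled[of w 1 "\<Sum>k\<in>UNIV. c $ k *\<^sub>R \<nu> k"] Gx_sum[OF finite[of UNIV], where t = "\<lambda>k. c $ k" and v = \<nu>]
    by eventually_elim (simp add: Z_def w_def)
  have Z2: "integrable M (\<lambda>\<omega>. (Z \<omega>)\<^sup>2)"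
    by (rule integrable_cong_AE_imp[OF Gx_square_integrable[of w]]) (use Z_eq in auto)
  have law: "(\<integral>\<omega>. iexp (s * Z \<omega> + (\<Sum>m\<in>UNIV. t m * Gx (\<nu> m) \<omega>)) \<partial>M)
      = exp (- (s\<^sup>2 * (norm w)\<^sup>2 + (norm (proj_A (\<Sum>m\<in>UNIV. t m *\<^sub>R \<nu> m)))\<^sup>2) / 2)" for s t
  proof -
    let ?v = "\<Sum>m\<in>UNIV. t m *\<^sub>R \<nu> m"
    have "AE \<omega> in M. s * Z \<omega> + (\<Sum>m\<in>UNIV. t m * Gx (\<nu> m) \<omega>) = Gx (?v + s *\<^sub>R w) \<omega>"
      using Gx_add_scaled[of ?v s w] Gx_sum[OF finite[of UNIV], where t = t and v = \<nu>] Z_eq by eventually_elim auto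
    then have "AE \<omega> in M. iexp (s * Z \<omega> + (\<Sum>m\<in>UNIV. t m * Gx (\<nu> m) \<omega>)) = iexp (Gx (?v + s *\<^sub>R w) \<omega>)"
      by eventually_elim (simp only:)
    then have "(\<integral>\<omega>. iexp (s * Z \<omega> + (\<Sum>m\<in>UNIV. t m * Gx (\<nu> m) \<omega>)) \<partial>M) = (\<integral>\<omega>. iexp (Gx (?v + s *\<^sub>R w) \<omega>) \<partial>M)"
      by (intro integral_cong_AE) measurable
    also have "\<dots> = exp (- (norm (proj_A (?v + s *\<^sub>R w)))\<^sup>2 / 2)" by (rule Gx_char)
    also have "proj_A (?v + s *\<^sub>R w) = proj_A ?v + s *\<^sub>R w"
      using bounded_linear.linear[OF bounded_linear_proj_A] by (simp add: linear_add linear_scale Prw)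
    also have "(norm (proj_A ?v + s *\<^sub>R w))\<^sup>2 = s\<^sup>2 * (norm w)\<^sup>2 + (norm (proj_A ?v))\<^sup>2"
    proof -
      have "?v \<in> span (range \<nu>)" by (intro span_sum span_scale span_base) auto
      then have "inner w (proj_A ?v) = 0" using inner_proj_A_left[of w ?v] w_orth by (simp add: Prw)
      then show ?thesis
        using inner_commute[of w "proj_A ?v"] unfolding power2_norm_eq_inner
        by (simp add: inner_add_left inner_add_right power2_eq_square)
    qed
    finally show ?thesis .
  qed
  have "AE \<omega> in M. real_cond_exp M (vimage_algebra (space M) ?Y borel) Z \<omega> = 0"
  proof (rule cond_exp_zero_if_reflection_symmetric)
    show "integrable M Z" by (rule square_integrable_imp_integrable[OF _ Z2]) simp
    show "(\<integral>\<omega>. iexp (s * Z \<omega> + (\<Sum>m\<in>UNIV. t m * Gx (\<nu> m) \<omega>)) \<partial>M)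
        = (\<integral>\<omega>. iexp (- s * Z \<omega> + (\<Sum>m\<in>UNIV. t m * Gx (\<nu> m) \<omega>)) \<partial>M)" for s t
      unfolding law by simp
  qed simp
  then have Z0: "AE \<omega> in M. real_cond_exp M (vimage_algebra (space M) ?Y borel) (\<lambda>\<omega>. Gx u \<omega> - ?h (?Y \<omega>)) \<omega> = 0"
    by (simp add: Z_def[abs_def])
  have Y: "?Y \<in> borel_measurable M" by (rule measurable_vec_lambda) simp
  have h: "?h \<in> borel_measurable borel"
    by (intro borel_measurable_continuous_onI continuous_intros)
  have X1: "integrable M (Gx u)"
    by (rule square_integrable_imp_integrable[OF _ Gx_square_integrable]) simp
  have Z2': "integrable M (\<lambda>\<omega>. (Gx u \<omega> - ?h (?Y \<omega>))\<^sup>2)"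
    using Z2 by (simp add: Z_def)
  show "is_conditional_mean M ?Y (Gx u) ?h" "is_mmse_estimator M ?Y (Gx u) ?h"
    using conditional_mean_and_mmse_if_residual[OF measurable_Gx Y h X1 Z2' Z0] by auto
qed

end

section \<open>Spline interpolation as conditional mean\<close>

theorem theorem9:
  fixes pair :: "'d::locally_convex_space \<Rightarrow> 's::locally_convex_space \<Rightarrow> real"
    and \<iota> :: "'s \<Rightarrow> 'd"
    and j :: "'s \<Rightarrow> 'l::{real_inner,complete_space}"
    and N0 :: nat
    and p :: "nat \<Rightarrow> 'd"
    and L :: "'s \<Rightarrow> 'l"
    and D :: "'d set"
    and Lx :: "'d \<Rightarrow> 'l"
    and A :: "'s \<Rightarrow> 'd"
    and \<kappa> :: "'s \<Rightarrow> 'h::{real_inner,complete_space}"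
    and \<phi> :: "nat \<Rightarrow> 'h"
    and a :: "'h \<Rightarrow> 'h \<Rightarrow> real"
    and M :: "'w measure"
    and G :: "'w \<Rightarrow> 'd"
    and Gx :: "'h \<Rightarrow> 'w \<Rightarrow> real"
    and \<nu> :: "'m::finite \<Rightarrow> 'h"
  defines "Y \<equiv> \<lambda>\<omega>. \<chi> m. Gx (\<nu> m) \<omega>"
  assumes "native_space pair \<iota> j N0 p L D Lx A \<kappa> \<phi> a"
    and "prob_space M"
    and "centered_gaussian_process M (\<lambda>x \<omega>. pair (G \<omega>) x)
           (\<lambda>x y. A_phi pair \<kappa> N0 p \<phi> a (\<kappa> x) (\<kappa> y))"
    and "extends_by_density M pair \<kappa> G Gx"
    and whitened: "centered_gaussian_process M (\<lambda>x. Gx (L_adjoint pair \<kappa> Lx (j x)))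
           (\<lambda>x y. pair (\<iota> x) y)"
    and "inj \<nu>" and "independent (range \<nu>)"
    and "span (\<phi> ` {..<N0}) \<subseteq> span (range \<nu>)"
  shows "\<exists>g0 :: real ^ 'm \<Rightarrow> 'd.
    (\<forall>y g. is_arg_min (\<lambda>g. norm (Lx g))
              (\<lambda>g. g \<in> native pair \<kappa> \<and> (\<forall>m. dual_ext pair \<kappa> g (\<nu> m) = y $ m)) g
            \<longleftrightarrow> g = g0 y) \<and>
    (\<forall>u. is_mmse_estimator M Y (Gx u) (\<lambda>y. dual_ext pair \<kappa> (g0 y) u)) \<and>
    (\<forall>u. is_conditional_mean M Y (Gx u) (\<lambda>y. dual_ext pair \<kappa> (g0 y) u))"
proof -
  interpret native_space pair \<iota> j N0 p L D Lx A \<kappa> \<phi> a by fact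
  interpret prob_space M by fact
  interpret native_gaussian_process pair \<iota> j N0 p L D Lx A \<kappa> \<phi> a M G Gx
    by unfold_locales fact+
  obtain C where C: "\<And>b :: real ^ 'm. \<And>m. inner (\<Sum>k\<in>UNIV. C b $ k *\<^sub>R \<nu> k) (\<nu> m) = b $ m"
    using gram_system_solvable[OF \<open>inj \<nu>\<close> \<open>independent (range \<nu>)\<close>] by blast
  define r where "r y = (\<Sum>k\<in>UNIV. C y $ k *\<^sub>R \<nu> k)" for y
  have r_span: "r y \<in> span (range \<nu>)" for y
    unfolding r_def by (intro span_sum span_scale span_base) auto
  have r_\<nu>: "inner (r y) (\<nu> m) = y $ m" for y m
    using C by (simp add: r_def)
  have "\<exists>f. f \<in> native pair \<kappa> \<and> dual_ext pair \<kappa> f = inner (r y)" for y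
    using dual_surj[OF bounded_linear_inner_right[of "r y"]] by blast
  then obtain g0 where g0: "\<And>y. g0 y \<in> native pair \<kappa>" "\<And>y. dual_ext pair \<kappa> (g0 y) = inner (r y)"
    by metis
  \<comment> \<open>The coefficients of the orthogonal projection of \<open>u\<close> onto the span of the observations.\<close>
  define c where "c u = C (\<chi> m. inner u (\<nu> m))" for u
  have orth: "inner (u - (\<Sum>k\<in>UNIV. c u $ k *\<^sub>R \<nu> k)) (\<nu> m) = 0" for u m
    by (simp add: inner_diff_left c_def C)
  have spline: "is_arg_min (\<lambda>g. norm (Lx g))
              (\<lambda>g. g \<in> native pair \<kappa> \<and> (\<forall>m. dual_ext pair \<kappa> g (\<nu> m) = y $ m)) g
            \<longleftrightarrow> g = g0 y" for y g
  proof -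
    have better: "norm (Lx (g0 y)) < norm (Lx f)"
      if "f \<in> native pair \<kappa>" "\<forall>m. dual_ext pair \<kappa> f (\<nu> m) = y $ m" "f \<noteq> g0 y" for f
      using assms(9) orth r_span[of y] g0 that r_\<nu>
      by (intro spline_strictly_minimal[where \<nu> = \<nu> and r = "r y"]) auto
    show ?thesis
      using g0 r_\<nu> better unfolding is_arg_min_def by (metis less_asym)
  qed
  have spline_at: "dual_ext pair \<kappa> (g0 y) u = (\<Sum>k\<in>UNIV. c u $ k * y $ k)" for y u
  proof -
    let ?w = "u - (\<Sum>k\<in>UNIV. c u $ k *\<^sub>R \<nu> k)"
    have "inner ?w (r y) = 0"
      unfolding r_def inner_sum_right inner_scaleR_right by (simp only: orth) simp
    then have "inner (r y) u = inner (r y) (\<Sum>k\<in>UNIV. c u $ k *\<^sub>R \<nu> k)"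
      by (simp add: inner_commute[of _ "r y"] inner_diff_right)
    then show ?thesis by (simp add: g0 inner_sum_right r_\<nu>)
  qed
  show ?thesis
    using spline regression_on_observations[OF assms(9) orth]
    by (intro exI[of _ g0]) (simp add: spline_at Y_def)
qed

end
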